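(* For all $m,n\in\mathbb N$, the beam-splitter state $\hat\sigma(m,n)$ is an extreme point of $\mathcal D_+$.
   Context: Let $\mathcal H=L^2(\mathbb R)$ with Fock basis $\{|k\rangle\}$, annihilation operator $\hat a$, $\hat n=\hat a^\dagger\hat a$, $\hat D(\alpha)=\exp(\alpha\hat a^\dagger-\alpha^*\hat a)$, $\hat\Pi(\alpha)=\hat D(\alpha)(-1)^{\hat n}\hat D(\alpha)^\dagger$; the Wigner function of a trace-class $\hat A$ is $W_{\hat A}(\alpha)=\frac2\pi\mathrm{Tr}[\hat A\hat\Pi(\alpha)]$. $\mathcal D_+$ is the convex set of density operators (positive semi-definite, unit trace) on $\mathcal H$ whose Wigner function is non-negative everywhere; a point is extreme if it is not the midpoint of two distinct points of the set. For two modes with annihilation operators $\hat a,\hat b$, let $\hat U_{1/2}=\exp\big(\frac{\pi}{4}(\hat a^\dagger\hat b-\hat a\hat b^\dagger)\big)$ be the balanced beam-splitter. The beam-splitter state is $\hat\sigma(m,n)=\mathrm{Tr}_2\big[\hat U_{1/2}(|m\rangle\langle m|\otimes|n\rangle\langle n|)\hat U_{1/2}^\dagger\big]$. *)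

theory Defs
  imports "HOL-Analysis.Analysis"
begin

text \<open>Operators are represented by their matrices in an orthonormal basis.
  For one mode, the basis is the Fock basis |k>, k :: nat, of L^2(R);
  for two modes, the product Fock basis |k>|l>, (k,l) :: nat \<times> nat.
  An operator X is the function (i,j) \<mapsto> <i|X|j>.\<close>

type_synonym 'i op = "'i \<Rightarrow> 'i \<Rightarrow> complex"

definition mmult :: "'i op \<Rightarrow> 'i op \<Rightarrow> 'i op" where
  "mmult A B = (\<lambda>i j. infsum (\<lambda>k. A i k * B k j) UNIV)"

definition madj :: "'i op \<Rightarrow> 'i op" where
  "madj A = (\<lambda>i j. cnj (A j i))"

definition madd :: "'i op \<Rightarrow> 'i op \<Rightarrow> 'i op" where
  "madd A B = (\<lambda>i j. A i j + B i j)"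

definition mscale :: "complex \<Rightarrow> 'i op \<Rightarrow> 'i op" where
  "mscale c A = (\<lambda>i j. c * A i j)"

definition mid :: "'i op" where
  "mid = (\<lambda>i j. if i = j then 1 else 0)"

fun mpow :: "'i op \<Rightarrow> nat \<Rightarrow> 'i op" where
  "mpow A 0 = mid"
| "mpow A (Suc k) = mmult A (mpow A k)"

text \<open>Operator exponential, defined entrywise by its power series
  (all generators used below map finite-particle vectors to finite-particle vectors).\<close>
definition mexp :: "'i op \<Rightarrow> 'i op" where
  "mexp G = (\<lambda>i j. (\<Sum>k. mpow G k i j / of_nat (fact k)))"

definition mtrace :: "'i op \<Rightarrow> complex" where
  "mtrace A = infsum (\<lambda>i. A i i) UNIV"

definition ann :: "nat op" where
  "ann = (\<lambda>i j. if Suc i = j then complex_of_real (sqrt (real j)) else 0)"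

definition cre :: "nat op" where
  "cre = madj ann"

definition parity :: "nat op" where
  "parity = (\<lambda>i j. if i = j then (-1) ^ i else 0)"

definition displ :: "complex \<Rightarrow> nat op" where
  "displ \<alpha> = mexp (madd (mscale \<alpha> cre) (mscale (- cnj \<alpha>) ann))"

definition dparity :: "complex \<Rightarrow> nat op" where
  "dparity \<alpha> = mmult (mmult (displ \<alpha>) parity) (madj (displ \<alpha>))"

definition wigner :: "nat op \<Rightarrow> complex \<Rightarrow> complex" where
  "wigner A \<alpha> = complex_of_real (2 / pi) * mtrace (mmult A (dparity \<alpha>))"

text \<open>Density operators: positive semi-definite (on all finitely supported
  vectors, which determines the bounded operator) with unit trace.\<close>
definition density :: "nat op \<Rightarrow> bool" where
  "density \<rho> \<longleftrightarrow>
     (\<forall>F v. finite F \<longrightarrow>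
        (let q = (\<Sum>i\<in>F. \<Sum>j\<in>F. cnj (v i) * \<rho> i j * v j) in Im q = 0 \<and> Re q \<ge> 0))
   \<and> ((\<lambda>i. \<rho> i i) has_sum 1) UNIV"

definition Dplus :: "nat op set" where
  "Dplus = {\<rho>. density \<rho> \<and> (\<forall>\<alpha>. Im (wigner \<rho> \<alpha>) = 0 \<and> Re (wigner \<rho> \<alpha>) \<ge> 0)}"

definition extreme_in :: "'i op \<Rightarrow> 'i op set \<Rightarrow> bool" where
  "extreme_in x S \<longleftrightarrow> x \<in> S \<and>
     \<not> (\<exists>a\<in>S. \<exists>b\<in>S. a \<noteq> b \<and> x = (\<lambda>i j. (a i j + b i j) / 2))"

definition on1 :: "nat op \<Rightarrow> (nat \<times> nat) op" where
  "on1 X = (\<lambda>(i,k) (j,l). if k = l then X i j else 0)"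

definition on2 :: "nat op \<Rightarrow> (nat \<times> nat) op" where
  "on2 X = (\<lambda>(i,k) (j,l). if i = j then X k l else 0)"

definition tensor :: "nat op \<Rightarrow> nat op \<Rightarrow> (nat \<times> nat) op" where
  "tensor X Y = (\<lambda>(i,k) (j,l). X i j * Y k l)"

definition ptrace2 :: "(nat \<times> nat) op \<Rightarrow> nat op" where
  "ptrace2 X = (\<lambda>i j. infsum (\<lambda>q. X (i,q) (j,q)) UNIV)"

definition proj :: "nat \<Rightarrow> nat op" where
  "proj m = (\<lambda>i j. if i = m \<and> j = m then 1 else 0)"

definition bs_half :: "(nat \<times> nat) op" where
  "bs_half = mexp (mscale (complex_of_real (pi / 4))
      (madd (mmult (on1 cre) (on2 ann)) (mscale (-1) (mmult (on1 ann) (on2 cre)))))"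

definition bs_state :: "nat \<Rightarrow> nat \<Rightarrow> nat op" where
  "bs_state m n = ptrace2 (mmult (mmult bs_half (tensor (proj m) (proj n))) (madj bs_half))"

end

(* In phase space the beam-splitter state has Wigner function proportional to
   exp(-2|a|^2) |H(a)|^2 with H(a) = h_mn(sqrt 2 a, - sqrt 2 conj(a)), where h_mn is the
       polynomial with
   exponential generating function exp(xz + yw + zw); the matrix elements of D(a) and of the
   displaced parity are, up to Gaussian and normalising factors, values of the same polynomials.
   This gives non-negativity. If sigma = (A + B)/2 with A, B in D_+, then A is supported on
   |0>, ..., |m+n>, and 0 <= W_A <= 2 W_sigma. On each line a = r e with |e| = 1 the function
   exp(2|a|^2) W_A is a polynomial in r of degree at most 2(m+n), dominated on the real line by the
   square of a polynomial of degree m+n all of whose roots are real (a Laguerre polynomial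
   in r^2). Hence it is a multiple of that square, and comparing the coefficients of r^(2(m+n)), to
   which only the (m+n, m+n) matrix entry contributes, shows that the multiple does not depend
   on e. So A is a multiple of sigma, and the unit trace gives A = sigma. *)
theory Submission
  imports Defs "HOL-Complex_Analysis.Complex_Analysis"
    "HOL-Computational_Algebra.Fundamental_Theorem_Algebra"
begin

text \<open>Operator exponentials are entrywise power series here, so each one is identified by
  exhibiting a column that is entire in a complex time and solves the linear ODE of the generator.
  Two models keep the sums explicit. For one mode, \<open>ito\<close> has a composition law that
  plays the role of the Weyl relation. For two modes, states are polynomials in X and Y (Bargmann
  picture) and the beam-splitter rotates the variables; homogeneity, which is photon-number
  conservation, makes the partial trace a finite sum. The square in the Wigner function comes from
  the balance c = s: together with the minus sign that parity puts on the first mode, it cancels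
  half of the terms in each recurrence, and what remains splits into two conjugate factors.
  Real-rootedness is obtained without orthogonality, by iterating p -> p' - p from x^m. Since a
  square has multiple roots, the domination argument is phrased as divisibility.\<close>

section \<open>Bivariate Hermite polynomials\<close>

text \<open>Exponential generating function \<open>exp (x z + y w + z w)\<close>.\<close>
fun ito :: "nat \<Rightarrow> nat \<Rightarrow> 'a \<Rightarrow> 'a \<Rightarrow> 'a::comm_ring_1" where
  "ito 0 n x y = y ^ n"
| "ito (Suc m) n x y = x * ito m n x y + of_nat n * ito m (n - 1) x y"

lemma ito_0_right: "ito m 0 x y = x ^ m"
  by (induction m) auto

text \<open>The generating function is symmetric under exchanging (x, z) with (y, w); the
  definition, recursive in the first index only, hides this. The truncated \<open>n - 1\<close> is
  harmless throughout, because its factor \<open>of_nat n\<close> vanishes at 0.\<close>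

lemma ito_Suc_right:
  "ito m (Suc n) x y = y * ito m n x y + of_nat m * ito (m - 1) n x y"
proof (induction m arbitrary: n)
  case 0
  then show ?case by simp
next
  case (Suc m)
  have *: "x * (of_nat m * ito (m - 1) n x y) + of_nat n * ito m n x y
      = y * (of_nat n * ito m (n - 1) x y) + of_nat m * ito m n x y"
  proof (cases n)
    case 0
    then show ?thesis by (cases m) (auto simp: algebra_simps)
  next
    case n: (Suc n')
    show ?thesis
    proof (cases m)
      case 0
      then show ?thesis using n by simp
    next
      case m: (Suc m')
      have "ito m n x y = y * ito m n' x y + of_nat m * ito m' n' x y"
        using Suc.IH[of n'] n m by simp
      moreover have "ito m n x y = x * ito m' n x y + of_nat n * ito m' n' x y"
        using n m by simp
      ultimately have "of_nat n * ito m n x y = of_nat n * (y * ito m n' x y + of_nat m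
          * ito m' n' x y)"
        \<comment> \<open>Weighting the two expansions of \<open>ito m n x y\<close> by n and m
          makes their last terms equal, so these cancel in the claimed identity.\<close>
        "of_nat m * ito m n x y = of_nat m * (x * ito m' n x y + of_nat n * ito m' n' x y)"
        by metis+
      then show ?thesis unfolding n m by (simp only: diff_Suc_1) (simp only: algebra_simps)
    qed
  qed
  have "ito (Suc m) (Suc n) x y = x * (y * ito m n x y + of_nat m * ito (m - 1) n x y)
      + of_nat (Suc n) * ito m n x y"
    using Suc.IH[of n] by simp
  also have "\<dots> = y * (x * ito m n x y) + ito m n x y + (x * (of_nat m * ito (m - 1) n x y)
      + of_nat n * ito m n x y)"
    by (simp add: algebra_simps)
  also have "\<dots> = y * ito (Suc m) n x y + of_nat (Suc m) * ito m n x y"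
    by (simp only: *) (simp add: algebra_simps)
  finally show ?case by simp
qed

lemma ito_swap: "ito m n x y = ito n m y x"
proof (induction m arbitrary: n)
  case 0
  then show ?case by (simp add: ito_0_right)
next
  case (Suc m)
  show ?case by (simp only: ito.simps(2) ito_Suc_right Suc.IH)
qed

lemma ito_minus: "ito m n (- x) (- y) = (- 1) ^ (m + n) * ito m n x y"
proof (induction m arbitrary: n)
  case 0
  then show ?case by (simp add: power_minus[of y])
next
  case (Suc m)
  show ?case
    by (cases n) (auto simp: Suc.IH algebra_simps)
qed

text \<open>Every monomial is of the form x^(m-k) y^(n-k), so both sides gain c^(m+n-k). Used with
  |c| = 1 to remove a phase, and with c = s to pass to a polynomial in s^2.\<close>

lemma ito_scale: "c ^ n * ito m n (c * x) y = c ^ m * ito m n x (c * y)"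
proof (induction m arbitrary: n)
  case 0
  then show ?case by (simp add: power_mult_distrib)
next
  case (Suc m)
  show ?case
  proof (cases n)
    case 0
    then show ?thesis using Suc.IH[of 0] by (simp add: ito_0_right power_mult_distrib mult_ac)
  next
    case (Suc n')
    have "c ^ n * ito (Suc m) n (c * x) y = c * x * (c ^ n * ito m n (c * x) y) + of_nat n * c
        * (c ^ n' * ito m n' (c * x) y)"
      using Suc by (simp add: algebra_simps)
    also have "\<dots> = c ^ Suc m * ito (Suc m) n x (c * y)"
      unfolding Suc.IH using Suc by (simp add: algebra_simps)
    finally show ?thesis .
  qed
qed

lemma cnj_ito: "cnj (ito m n x y) = ito m n (cnj x) (cnj y)"
  by (induction m arbitrary: n) auto

lemma poly_ito: "poly (ito m n p q) r = ito m n (poly p r) (poly q r)"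
  by (induction m arbitrary: n) auto

lemma DERIV_ito:
  fixes a b t :: complex
  shows "((\<lambda>t. ito m n (t * a) (t * b)) has_field_derivative
    of_nat m * a * ito (m - 1) n (t * a) (t * b) + of_nat n * b * ito m (n - 1) (t * a) (t
        * b)) (at t)"
proof (induction m arbitrary: n)
  case 0
  show ?case by (auto intro!: derivative_eq_intros)
next
  case (Suc m)
  have *: "of_nat m * ito m n x y = of_nat m * (x * ito (m - 1) n x y + of_nat n
      * ito (m - 1) (n - 1) x y)"
    for x y :: complex by (cases m) auto
  have "((\<lambda>t. t * a * ito m n (t * a) (t * b) + of_nat n * ito m (n - 1) (t * a) (t
      * b)) has_field_derivative
      (a * ito m n (t * a) (t * b) + (of_nat m * a * ito (m - 1) n (t * a) (t * b)
         + of_nat n * b * ito m (n - 1) (t * a) (t * b)) * (t * a))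
      + of_nat n * (of_nat m * a * ito (m - 1) (n - 1) (t * a) (t * b)
         + of_nat (n - 1) * b * ito m (n - 1 - 1) (t * a) (t * b))) (at t)"
    by (auto intro!: derivative_eq_intros Suc.IH)
  also have "(a * ito m n (t * a) (t * b) + (of_nat m * a * ito (m - 1) n (t * a) (t * b)
         + of_nat n * b * ito m (n - 1) (t * a) (t * b)) * (t * a))
      + of_nat n * (of_nat m * a * ito (m - 1) (n - 1) (t * a) (t * b)
         + of_nat (n - 1) * b * ito m (n - 1 - 1) (t * a) (t * b))
     = a * ito m n (t * a) (t * b) + a * (of_nat m * (t * a * ito (m - 1) n (t * a) (t * b) 
         + of_nat n * ito (m - 1) (n - 1) (t * a) (t * b)))
       + of_nat n * b * (t * a * ito m (n - 1) (t * a) (t * b) + of_nat (n - 1)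
           * ito m (n - 1 - 1) (t * a) (t * b))"
    by (simp only: algebra_simps)
  also have "\<dots> = of_nat (Suc m) * a * ito (Suc m - 1) n (t * a) (t * b)
       + of_nat n * b * ito (Suc m) (n - 1) (t * a) (t * b)"
    unfolding *[symmetric] by (simp add: algebra_simps)
  finally show ?case by simp
qed

text \<open>Each contraction zw lowers the total degree by 2, so only x^m y^n reaches degree m + n.
  The coefficient is given at this index, not as a leading coefficient, since \<open>a\<close> or
  \<open>b\<close> may be 0.\<close>

lemma ito_monom_degree:
  "degree (ito m n [:0, a:] [:0, b:]) \<le> m + n \<and>
   coeff (ito m n [:0, a:] [:0, b:]) (m + n) = a ^ m * b ^ n"
proof (induction m arbitrary: n)
  case 0
  have "[:0, b:] ^ n = monom (b ^ n) n" for n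
    by (induction n) (auto simp: monom_0 monom_Suc smult_monom)
  then show ?case by (simp add: degree_monom_le)
next
  case (Suc m)
  have *: "coeff ([:0, a:] * p) (Suc k) = a * coeff p k" for p k by simp
  have d1: "degree ([:0, a:] * ito m n [:0, a:] [:0, b:]) \<le> Suc m + n"
    using Suc.IH[of n] degree_mult_le[of "[:0, a:]" "ito m n [:0, a:] [:0, b:]"]
    by (auto split: if_splits)
  have d2: "degree (of_nat n * ito m (n - 1) [:0, a:] [:0, b:]) < Suc m + n"
  proof -
    have "of_nat n * ito m (n - 1) [:0, a:] [:0, b:]
        = smult (of_nat n) (ito m (n - 1) [:0, a:] [:0, b:])"
      by (simp add: of_nat_poly)
    then have "degree (of_nat n * ito m (n - 1) [:0, a:] [:0, b:]) \<le> m + (n - 1)"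
      using Suc.IH[of "n - 1"] degree_smult_le le_trans by metis
    then show ?thesis by linarith
  qed
  have "degree (ito (Suc m) n [:0, a:] [:0, b:]) \<le> Suc m + n"
    using d1 d2 by (simp only: ito.simps) (intro degree_add_le, auto)
  moreover have "coeff (ito (Suc m) n [:0, a:] [:0, b:]) (Suc m + n) = a ^ Suc m * b ^ n"
    using coeff_eq_0[OF d2] Suc.IH[of n] by (simp only: ito.simps coeff_add) simp
  ultimately show ?case ..
qed

lemma has_sum_Suc_shift:
  fixes f :: "nat \<Rightarrow> 'a::{comm_monoid_add, topological_space}"
  assumes "((\<lambda>k. f (Suc k)) has_sum s) UNIV" "f 0 = 0"
  shows "(f has_sum s) UNIV"
proof -
  have "(f has_sum s) (range Suc)"
    using assms(1) by (subst has_sum_reindex) (auto simp: o_def)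
  moreover have "f k = 0" if "k \<notin> range Suc" for k
    using that assms(2) by (cases k) auto
  ultimately show ?thesis
    by (subst has_sum_cong_neutral[where T = "range Suc" and g = f]) auto
qed

text \<open>Summing over k contracts w of the first generating function with z of the second: x z +
  v w + (y + z)(u + w) = y u + (x + u) z + (y + v) w + z w. For displacement matrices this is the
  Weyl relation.\<close>

lemma ito_has_sum:
  fixes x y u v :: complex
  shows "((\<lambda>k. ito i k x y * ito k j u v / fact k) has_sum
           exp (y * u) * ito i j (x + u) (y + v)) UNIV"
proof (induction i arbitrary: j)
  case 0
  show ?case
  proof (induction j)
    case 0
    have "(\<lambda>k. (y * u) ^ k / fact k) sums exp (y * u)"
      using exp_converges[of "y * u"] by (simp add: scaleR_conv_of_real field_simps)
    moreover have "summable (\<lambda>k. norm ((y * u) ^ k / fact k))"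
      using summable_norm_exp[of "y * u"] by (simp add: scaleR_conv_of_real field_simps)
    ultimately show ?case
      by (simp add: ito_0_right power_mult_distrib norm_summable_imp_has_sum)
  next
    case (Suc j)
    let ?f = "\<lambda>k. y ^ k * ito k j u v / fact k"
    have *: "((\<lambda>k. y * ?f k) has_sum y * (exp (y * u) * (y + v) ^ j)) UNIV"
      using Suc by (intro has_sum_cmult_right) simp
    have "((\<lambda>k. y ^ k * of_nat k * ito (k - 1) j u v / fact k) has_sum y * (exp (y * u) * (y
        + v) ^ j)) UNIV"
    proof (rule has_sum_Suc_shift)
      have "y * ?f k = y ^ Suc k * of_nat (Suc k) * ito (Suc k - 1) j u v / fact (Suc k)" for k
        by (simp del: of_nat_Suc)
      then show "((\<lambda>k. y ^ Suc k * of_nat (Suc k) * ito (Suc k - 1) j u v / fact (Suc k))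
          has_sum y * (exp (y * u) * (y + v) ^ j)) UNIV"
        using * by (simp only:)
    qed simp
    moreover have "((\<lambda>k. v * ?f k) has_sum v * (exp (y * u) * (y + v) ^ j)) UNIV"
      using Suc by (intro has_sum_cmult_right) simp
    ultimately have "((\<lambda>k. v * ?f k + y ^ k * of_nat k * ito (k - 1) j u v / fact k) has_sum
       v * (exp (y * u) * (y + v) ^ j) + y * (exp (y * u) * (y + v) ^ j)) UNIV"
      by (intro has_sum_add)
    then show ?case
      by (simp add: ito_Suc_right algebra_simps add_divide_distrib)
  qed
next
  case (Suc i)
  let ?f = "\<lambda>j k. ito i k x y * ito k j u v / fact k"
  let ?s = "\<lambda>j. exp (y * u) * ito i j (x + u) (y + v)"
  have "((\<lambda>k. u * ?f j k + of_nat j * ?f (j - 1) k) has_sum u * ?s j + of_nat j * ?s (j - 1)) UNIV"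
    by (intro has_sum_add has_sum_cmult_right Suc.IH)
  \<comment> \<open>The lowering of k in the left factor cancels against \<open>fact\<close> after
    the shift k -> k + 1 and becomes a raising of k in the right factor, where the defining
    recursion applies.\<close>
  moreover have "u * ?f j k + of_nat j * ?f (j - 1) k
      = of_nat (Suc k) * ito i (Suc k - 1) x y * ito (Suc k) j u v / fact (Suc k)" for k
  proof -
    have "of_nat (Suc k) * ito i (Suc k - 1) x y * ito (Suc k) j u v / fact (Suc k)
        = ito i k x y * ito (Suc k) j u v / fact k"
      by (simp del: of_nat_Suc ito.simps)
    also have "\<dots> = u * ?f j k + of_nat j * ?f (j - 1) k"
      by (simp add: algebra_simps add_divide_distrib)
    finally show ?thesis by simp
  qed
  ultimately have "((\<lambda>k. of_nat (Suc k) * ito i (Suc k - 1) x y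
      * ito (Suc k) j u v / fact (Suc k)) has_sum
      u * ?s j + of_nat j * ?s (j - 1)) UNIV"
    by (simp only:)
  then have "((\<lambda>k. of_nat k * ito i (k - 1) x y * ito k j u v / fact k) has_sum
      u * ?s j + of_nat j * ?s (j - 1)) UNIV"
    by (rule has_sum_Suc_shift) simp
  moreover have "((\<lambda>k. x * ?f j k) has_sum x * ?s j) UNIV"
    by (intro has_sum_cmult_right Suc.IH)
  ultimately have "((\<lambda>k. x * ?f j k + of_nat k * ito i (k - 1) x y * ito k j u v / fact k) has_sum
      x * ?s j + (u * ?s j + of_nat j * ?s (j - 1))) UNIV"
    by (intro has_sum_add)
  then show ?case
    by (simp add: algebra_simps add_divide_distrib)
qed

section \<open>Rotated monomials\<close>

text \<open>A polynomial in \<open>X\<close>, \<open>Y\<close> is represented by its coefficient function;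
  \<open>rot c s m n\<close> is \<open>(c X - s Y)^m (s X + c Y)^n\<close>.\<close>
type_synonym 'a bicoeff = "nat \<Rightarrow> nat \<Rightarrow> 'a"

text \<open>Bargmann picture: X^p Y^q stands for sqrt(p! q!) |p>|q>, so that \<open>mulX\<close>,
  \<open>mulY\<close>, \<open>derX\<close>, \<open>derY\<close> are the two creation and the two
  annihilation operators.\<close>

definition mulX :: "'a::comm_ring_1 bicoeff \<Rightarrow> 'a bicoeff" where
  "mulX f = (\<lambda>p q. if p = 0 then 0 else f (p - 1) q)"

definition mulY :: "'a::comm_ring_1 bicoeff \<Rightarrow> 'a bicoeff" where
  "mulY f = (\<lambda>p q. if q = 0 then 0 else f p (q - 1))"

definition derX :: "'a::comm_ring_1 bicoeff \<Rightarrow> 'a bicoeff" where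
  "derX f = (\<lambda>p q. of_nat (Suc p) * f (Suc p) q)"

definition derY :: "'a::comm_ring_1 bicoeff \<Rightarrow> 'a bicoeff" where
  "derY f = (\<lambda>p q. of_nat (Suc q) * f p (Suc q))"

definition lin :: "'a::comm_ring_1 \<Rightarrow> 'a bicoeff \<Rightarrow> 'a \<Rightarrow> 'a bicoeff \<Rightarrow> 'a bicoeff" where
  "lin a f b g = (\<lambda>p q. a * f p q + b * g p q)"

fun rot :: "'a \<Rightarrow> 'a \<Rightarrow> nat \<Rightarrow> nat \<Rightarrow> 'a::comm_ring_1 bicoeff" where
  "rot c s 0 0 = (\<lambda>p q. if p = 0 \<and> q = 0 then 1 else 0)"
| "rot c s 0 (Suc n) = lin s (mulX (rot c s 0 n)) c (mulY (rot c s 0 n))"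
| "rot c s (Suc m) n = lin c (mulX (rot c s m n)) (- s) (mulY (rot c s m n))"

lemma mulX_lin: "mulX (lin a f b g) = lin a (mulX f) b (mulX g)"
  by (auto simp: mulX_def lin_def fun_eq_iff)

lemma mulY_lin: "mulY (lin a f b g) = lin a (mulY f) b (mulY g)"
  by (auto simp: mulY_def lin_def fun_eq_iff)

lemma mulX_mulY: "mulX (mulY f) = mulY (mulX f)"
  by (auto simp: mulX_def mulY_def fun_eq_iff)

lemma derX_lin: "derX (lin a f b g) = lin a (derX f) b (derX g)"
  by (auto simp: derX_def lin_def fun_eq_iff algebra_simps)

lemma derY_lin: "derY (lin a f b g) = lin a (derY f) b (derY g)"
  by (auto simp: derY_def lin_def fun_eq_iff algebra_simps)

lemma derX_mulX: "derX (mulX f) = lin 1 f 1 (mulX (derX f))"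
  by (auto simp: derX_def mulX_def lin_def fun_eq_iff algebra_simps)

lemma derX_mulY: "derX (mulY f) = mulY (derX f)"
  by (auto simp: derX_def mulY_def fun_eq_iff algebra_simps)

lemma derY_mulX: "derY (mulX f) = mulX (derY f)"
  by (auto simp: derY_def mulX_def fun_eq_iff algebra_simps)

lemma derY_mulY: "derY (mulY f) = lin 1 f 1 (mulY (derY f))"
  by (auto simp: derY_def mulY_def lin_def fun_eq_iff algebra_simps)

lemma rot_Suc_right: "rot c s m (Suc n) = lin s (mulX (rot c s m n)) c (mulY (rot c s m n))"
proof (induction m)
  case 0
  show ?case by simp
next
  case (Suc m)
  show ?case
    by (simp only: rot.simps(3) Suc.IH mulX_lin mulY_lin mulX_mulY)
       (auto simp: lin_def fun_eq_iff algebra_simps)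
qed

text \<open>Homogeneity, i.e. conservation of the photon number; it bounds every later sum and makes
  the reduced state diagonal.\<close>

lemma rot_eq_0: "p + q \<noteq> m + n \<Longrightarrow> rot c s m n p q = 0"
proof (induction m arbitrary: p q)
  case 0
  then show ?case
  proof (induction n arbitrary: p q)
    case 0
    then show ?case by simp
  next
    case (Suc n)
    show ?case using Suc.prems Suc.IH[of "p - 1" q] Suc.IH[of p "q - 1"]
      by (auto simp: lin_def mulX_def mulY_def)
  qed
next
  case (Suc m)
  show ?case using Suc.prems Suc.IH[of "p - 1" q] Suc.IH[of p "q - 1"]
    by (auto simp: lin_def mulX_def mulY_def)
qed

lemma rot_one_zero: "rot 1 0 m n p q = (if p = m \<and> q = n then 1 else 0)"
proof (induction m arbitrary: p q)
  case 0
  show ?case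
    by (induction n arbitrary: p q) (auto simp: lin_def mulX_def mulY_def)
next
  case (Suc m)
  then show ?case by (auto simp: lin_def mulX_def mulY_def)
qed

lemma rot_0_pred:
  "of_nat n * rot c s 0 n p q
    = of_nat n * (s * mulX (rot c s 0 (n - 1)) p q + c * mulY (rot c s 0 (n - 1)) p q)"
  by (cases n) (simp_all add: lin_def)

lemma rot_pred:
  "of_nat m * rot c s m n p q
    = of_nat m * (c * mulX (rot c s (m - 1) n) p q - s * mulY (rot c s (m - 1) n) p q)"
  by (cases m) (simp_all add: lin_def)

lemma derX_rot:
  "derX (rot c s m n) = lin (of_nat m * c) (rot c s (m - 1) n) (of_nat n * s) (rot c s m (n - 1))"
proof (induction m)
  case 0
  show ?case
  proof (induction n)
    case 0
    show ?case by (simp add: derX_def lin_def fun_eq_iff)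
  next
    case (Suc n)
    have "derX (rot c s 0 (Suc n)) p q = s * rot c s 0 n p q
        + s * (of_nat n * (s * mulX (rot c s 0 (n - 1)) p q + c * mulY (rot c s 0 (n - 1)) p q))"
            for p q
      by (simp only: rot.simps(2) derX_lin derX_mulX derX_mulY Suc.IH mulX_lin mulY_lin)
         (simp add: lin_def algebra_simps)
    then show ?case
      by (simp only: rot_0_pred[symmetric]) (simp add: lin_def fun_eq_iff algebra_simps)
  qed
next
  case (Suc m)
  have "derX (rot c s (Suc m) n) p q = c * rot c s m n p q
      + c * (of_nat m * (c * mulX (rot c s (m - 1) n) p q - s * mulY (rot c s (m - 1) n) p q))
      + of_nat n * s * rot c s (Suc m) (n - 1) p q" for p q
    by (simp only: rot.simps(3) derX_lin derX_mulX derX_mulY Suc.IH mulX_lin mulY_lin)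
       (simp add: lin_def algebra_simps)
  then show ?case
    by (simp only: rot_pred[symmetric]) (simp add: lin_def fun_eq_iff algebra_simps)
qed

lemma derY_rot:
  "derY (rot c s m n) = lin (- of_nat m * s) (rot c s (m - 1) n) (of_nat n * c) (rot c s m (n - 1))"
proof (induction m)
  case 0
  show ?case
  proof (induction n)
    case 0
    show ?case by (simp add: derY_def lin_def fun_eq_iff)
  next
    case (Suc n)
    have "derY (rot c s 0 (Suc n)) p q = c * rot c s 0 n p q
        + c * (of_nat n * (s * mulX (rot c s 0 (n - 1)) p q + c * mulY (rot c s 0 (n - 1)) p q))"
            for p q
      by (simp only: rot.simps(2) derY_lin derY_mulX derY_mulY Suc.IH mulX_lin mulY_lin)
         (simp add: lin_def algebra_simps)
    then show ?case
      by (simp only: rot_0_pred[symmetric]) (simp add: lin_def fun_eq_iff algebra_simps)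
  qed
next
  case (Suc m)
  have "derY (rot c s (Suc m) n) p q = - s * rot c s m n p q
      - s * (of_nat m * (c * mulX (rot c s (m - 1) n) p q - s * mulY (rot c s (m - 1) n) p q))
      + of_nat n * c * rot c s (Suc m) (n - 1) p q" for p q
    by (simp only: rot.simps(3) derY_lin derY_mulX derY_mulY Suc.IH mulX_lin mulY_lin)
       (simp add: lin_def algebra_simps)
  then show ?case
    by (simp only: rot_pred[symmetric]) (simp add: lin_def fun_eq_iff algebra_simps)
qed

text \<open>The left-hand side is the beam-splitter generator \<open>a\<^sup>\<dagger> b - a b\<^sup>\<dagger>\<close> acting on polynomials.\<close>
lemma generator_rot:
  "lin 1 (mulX (derY (rot c s m n))) (- 1) (mulY (derX (rot c s m n)))
   = lin (- of_nat m) (rot c s (m - 1) (Suc n)) (of_nat n) (rot c s (Suc m) (n - 1))"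
  by (simp only: derX_rot derY_rot rot_Suc_right rot.simps(3) mulX_lin mulY_lin)
     (simp add: lin_def fun_eq_iff algebra_simps)

section \<open>Sesquilinear forms on two-mode polynomials and their ladder recurrences\<close>

lemma sum_shift:
  fixes f g :: "nat \<Rightarrow> 'a::comm_ring_1"
  assumes "f K = 0"
  shows "(\<Sum>p\<le>K. (if p = 0 then 0 else f (p - 1)) * g p) = (\<Sum>p\<le>K. f p * g (Suc p))"
proof (cases K)
  case 0
  then show ?thesis using assms by simp
next
  case (Suc K')
  have "(\<Sum>p\<le>K. (if p = 0 then 0 else f (p - 1)) * g p) = (\<Sum>p\<le>K'. f p * g (Suc p))"
    unfolding Suc by (subst sum.atMost_Suc_shift) simp
  also have "\<dots> = (\<Sum>p\<le>K. f p * g (Suc p))"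
    using assms unfolding Suc by simp
  finally show ?thesis .
qed

text \<open>For this inner product (with \<open>K\<close> a bound on the degrees) multiplication by a variable is
  adjoint to differentiation.\<close>
definition fockprod :: "nat \<Rightarrow> complex bicoeff \<Rightarrow> complex bicoeff \<Rightarrow> complex" where
  "fockprod K f g = (\<Sum>p\<le>K. \<Sum>q\<le>K. f p q * (g p q * fact p * fact q))"

lemma fockprod_lin_left: "fockprod K (lin a f b f') g = a * fockprod K f g + b * fockprod K f' g"
  by (simp add: fockprod_def lin_def algebra_simps sum.distrib sum_distrib_left)

lemma fockprod_lin_right: "fockprod K g (lin a f b f') = a * fockprod K g f + b * fockprod K g f'"
  by (simp add: fockprod_def lin_def algebra_simps sum.distrib sum_distrib_left)

lemma fockprod_mulX:
  assumes "\<And>q. f K q = 0"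
  shows "fockprod K (mulX f) g = fockprod K f (derX g)"
proof -
  have *: "fockprod K f g = (\<Sum>q\<le>K. \<Sum>p\<le>K. f p q * (g p q * fact p * fact q))" for f g
    unfolding fockprod_def by (rule sum.swap)
  have "(\<Sum>p\<le>K. mulX f p q * (g p q * fact p * fact q))
      = (\<Sum>p\<le>K. f p q * (g (Suc p) q * fact (Suc p) * fact q))" for q
    unfolding mulX_def using assms by (intro sum_shift[where f = "\<lambda>p. f p q"]) auto
  then show ?thesis unfolding * by (simp add: derX_def mult_ac del: of_nat_Suc)
qed

lemma fockprod_mulY:
  assumes "\<And>p. f p K = 0"
  shows "fockprod K (mulY f) g = fockprod K f (derY g)"
proof -
  have "(\<Sum>q\<le>K. mulY f p q * (g p q * fact p * fact q))
      = (\<Sum>q\<le>K. f p q * (g p (Suc q) * fact p * fact (Suc q)))" for p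
    unfolding mulY_def using assms by (intro sum_shift[where f = "\<lambda>q. f p q"]) auto
  then show ?thesis unfolding fockprod_def by (simp add: derY_def mult_ac del: of_nat_Suc)
qed

text \<open>Unitarity of the rotation on one basis state: a linear factor peeled off on the left
  differentiates the right argument; the mixed terms cancel and c^2 + s^2 = 1 leaves the exponent as
  factor.\<close>

lemma fockprod_rot:
  assumes "m + n \<le> K" "c\<^sup>2 + s\<^sup>2 = 1"
  shows "fockprod K (rot c s m n) (rot c s m n) = fact m * fact n"
  using assms(1)
proof (induction m)
  case 0
  then show ?case
  proof (induction n)
    case 0
    have "fockprod K (rot c s 0 0) (rot c s 0 0) = (\<Sum>p\<le>K. if p = 0 then (\<Sum>q\<le>K. if q
        = 0 then 1 else 0) else 0)"
      unfolding fockprod_def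
    proof (rule sum.cong[OF refl], goal_cases)
      case (1 p)
      have "(\<Sum>q\<le>K. rot c s 0 0 p q * (rot c s 0 0 p q * fact p * fact q))
          = (\<Sum>q\<le>K. if q = 0 then if p = 0 then 1 else 0 else 0)"
        by (rule sum.cong) auto
      then show ?case by simp
    qed
    also have "\<dots> = 1" by simp
    finally show ?case by simp
  next
    case (Suc n)
    have 0: "rot c s 0 n K q = 0" "rot c s 0 n q K = 0" for q
      using Suc.prems by (auto intro!: rot_eq_0)
    have *: "c * (c * X) + s * (s * X) = X" for X
      using assms(2) by (metis distrib_right mult.assoc mult_1 power2_eq_square)
    show ?case using Suc 0
      by (simp only: rot.simps(2)[of c s n] fockprod_lin_left fockprod_mulX fockprod_mulY)
         (simp add: derX_rot derY_rot rot.simps(2)[symmetric] fockprod_lin_right del: rot.simps,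
             simp add: algebra_simps *)
  qed
next
  case (Suc m)
  have 0: "rot c s m n K q = 0" "rot c s m n q K = 0" for q
    using Suc.prems by (auto intro!: rot_eq_0)
  have *: "c * (c * X) + s * (s * X) = X" for X
    using assms(2) by (metis distrib_right mult.assoc mult_1 power2_eq_square)
  show ?case using Suc 0
    by (simp only: rot.simps(3)[of c s m n] fockprod_lin_left fockprod_mulX fockprod_mulY)
       (simp add: derX_rot derY_rot rot.simps(3)[symmetric] fockprod_lin_right del: rot.simps,
           simp add: algebra_simps *)
qed

text \<open>Matrix element of (displaced parity) \<open>\<otimes>\<close> identity between two unnormalised two-mode states.\<close>
definition wigprod :: "nat \<Rightarrow> complex \<Rightarrow> complex \<Rightarrow> complex bicoeff \<Rightarrow> complex bicoeff \<Rightarrow> complex" where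
  "wigprod K x y f g =
     (\<Sum>q\<le>K. \<Sum>p'\<le>K. \<Sum>p\<le>K. f p q * (g p' q * fact q * (- 1) ^ p' * ito p p' x y))"

lemma wigprod_lin_left: "wigprod K x y (lin a f b f') g
    = a * wigprod K x y f g + b * wigprod K x y f' g"
  by (simp add: wigprod_def lin_def algebra_simps sum.distrib sum_distrib_left)

lemma wigprod_lin_right: "wigprod K x y g (lin a f b f')
    = a * wigprod K x y g f + b * wigprod K x y g f'"
  by (simp add: wigprod_def lin_def algebra_simps sum.distrib sum_distrib_left)

text \<open>Parity anticommutes with the ladder operators, whence the minus sign; the displacement
  contributes the scalar \<open>x\<close>. The second assumption is needed because
  \<open>derX g\<close> at the upper end K reads \<open>g\<close> at \<open>Suc K\<close>.\<close>

lemma wigprod_mulX: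
  assumes "\<And>q. f K q = 0" "\<And>q. g (Suc K) q = 0"
  shows "wigprod K x y (mulX f) g = x * wigprod K x y f g - wigprod K x y f (derX g)"
proof -
  have 1: "(\<Sum>p'\<le>K. g p' q * fact q * (- 1) ^ p' * (of_nat p' * ito p (p' - 1) x y))
      = - (\<Sum>p'\<le>K. derX g p' q * fact q * (- 1) ^ p' * ito p p' x y)" (is "?l = _") for p q
  proof -
    have "?l = (\<Sum>p'\<le>Suc K. g p' q * fact q * (- 1) ^ p' * (of_nat p' * ito p (p' - 1) x y))"
      using assms(2) by simp
    also have "\<dots> = (\<Sum>p'\<le>K. g (Suc p') q * fact q * (- 1) ^ Suc p' * (of_nat (Suc p')
        * ito p p' x y))"
      by (subst sum.atMost_Suc_shift) simp
    finally show ?thesis by (simp add: derX_def mult_ac sum_negf del: of_nat_Suc)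
  qed
  have "wigprod K x y (mulX f) g
     = (\<Sum>q\<le>K. \<Sum>p'\<le>K. \<Sum>p\<le>K. f p q * (g p' q * fact q * (- 1) ^ p' * ito (Suc p) p' x y))"
    unfolding wigprod_def mulX_def
    by (intro sum.cong refl sum_shift[where f = "\<lambda>p. f p q" for q] assms(1))
  also have "\<dots> = x * wigprod K x y f g
     + (\<Sum>q\<le>K. \<Sum>p'\<le>K. \<Sum>p\<le>K. f p q * (g p' q * fact q * (- 1) ^ p' * (of_nat p'
         * ito p (p' - 1) x y)))"
    by (simp add: wigprod_def algebra_simps sum.distrib sum_distrib_left)
  also have "(\<Sum>q\<le>K. \<Sum>p'\<le>K. \<Sum>p\<le>K. f p q * (g p' q * fact q * (- 1) ^ p' * (of_nat p'
      * ito p (p' - 1) x y)))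
     = (\<Sum>q\<le>K. \<Sum>p\<le>K. f p q * (\<Sum>p'\<le>K. g p' q * fact q * (- 1) ^ p' * (of_nat p'
         * ito p (p' - 1) x y)))"
    by (rule sum.cong[OF refl], subst sum.swap) (simp add: sum_distrib_left)
  also have "\<dots> = - (\<Sum>q\<le>K. \<Sum>p\<le>K. \<Sum>p'\<le>K. f p q * (derX g p' q * fact q * (- 1) ^ p' * ito p p' x y))"
    unfolding 1 by (simp add: sum_negf sum_distrib_left)
  also have "(\<Sum>q\<le>K. \<Sum>p\<le>K. \<Sum>p'\<le>K. f p q * (derX g p' q * fact q * (- 1) ^ p' * ito p p' x y))
      = wigprod K x y f (derX g)"
    unfolding wigprod_def by (rule sum.cong[OF refl sum.swap])
  finally show ?thesis by simp
qed

lemma wigprod_swap: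
  "wigprod K x y f g =
    (\<Sum>p'\<le>K. \<Sum>p\<le>K. \<Sum>q\<le>K. f p q * (g p' q * fact q * (- 1) ^ p' * ito p p' x y))"
  unfolding wigprod_def by (subst sum.swap) (rule sum.cong[OF refl sum.swap])

lemma wigprod_mulY:
  assumes "\<And>p. f p K = 0"
  shows "wigprod K x y (mulY f) g = wigprod K x y f (derY g)"
proof -
  have "(\<Sum>q\<le>K. mulY f p q * (g p' q * fact q * (- 1) ^ p' * ito p p' x y))
      = (\<Sum>q\<le>K. f p q * (g p' (Suc q) * fact (Suc q) * (- 1) ^ p' * ito p p' x y))" for p p'
    unfolding mulY_def using assms by (intro sum_shift[where f = "\<lambda>q. f p q"]) auto
  then show ?thesis unfolding wigprod_swap by (simp add: derY_def mult_ac del: of_nat_Suc)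
qed

lemma rot_right_0: "rot c s m n p 0 = (if p = m + n then c ^ m * s ^ n else 0)"
proof (induction m arbitrary: p)
  case 0
  show ?case by (induction n arbitrary: p) (auto simp: lin_def mulX_def mulY_def)
next
  case (Suc m)
  show ?case using Suc.IH by (auto simp: lin_def mulX_def mulY_def)
qed

text \<open>With equal coefficients, peeling off (k X - k Y) differentiates the right argument by X
  and Y with equal signs, which kills the m' term and doubles the n' term; 2 k^2 = 1 normalises it.
  Peeling off (k X + k Y) does the reverse. So m interacts only with n', and n only with m', and the
  value factorises.\<close>

lemma wigprod_rot:
  assumes "m + n \<le> K" "m' + n' \<le> K" "2 * k * k = (1::complex)"
  shows "wigprod K x y (rot k k m n) (rot k k m' n') =
    (- 1) ^ (m' + n') * ito m n' (k * x) (k * y) * ito n m' (k * x) (k * y)"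
  using assms(1,2)
proof (induction m arbitrary: m' n')
  case 0
  then show ?case
  proof (induction n arbitrary: m' n')
    case 0
    have "wigprod K x y (rot k k 0 0) (rot k k m' n')
      = (\<Sum>q\<le>K. if q = 0 then (\<Sum>p'\<le>K. rot k k m' n' p' 0 * (- 1) ^ p' * y ^ p') else 0)"
      unfolding wigprod_def
    proof (intro sum.cong refl, goal_cases)
      case (1 q)
      have "(\<Sum>p\<le>K. rot k k 0 0 p q * (rot k k m' n' p' q * fact q * (- 1) ^ p' * ito p p' x y))
        = (\<Sum>p\<le>K. if p = 0 then if q = 0 then rot k k m' n' p' 0 * (- 1) ^ p'
            * y ^ p' else 0 else 0)" for p'
        by (intro sum.cong) auto
      then show ?case by (simp add: sum.delta')
    qed
    also have "\<dots> = (\<Sum>p'\<le>K. if p' = m' + n' then k ^ m' * k ^ n' * (- 1) ^ p' * y ^ p' else 0)"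
      by (simp only: rot_right_0) (simp add: if_distrib[of "\<lambda>x. x * _"] cong: if_cong)
    also have "\<dots> = k ^ m' * k ^ n' * (- 1) ^ (m' + n') * y ^ (m' + n')"
      using 0 by simp
    finally show ?case by (simp add: power_add power_mult_distrib algebra_simps)
  next
    case (Suc n)
    have 0: "rot k k 0 n K q = 0" "rot k k 0 n q K = 0" "rot k k m' n' (Suc K) q = 0" for q
      using Suc.prems by (auto intro!: rot_eq_0)
    let ?W = "\<lambda>m' n'. wigprod K x y (rot k k 0 n) (rot k k m' n')"
    have "wigprod K x y (rot k k 0 (Suc n)) (rot k k m' n')
        = k * x * ?W m' n' - 2 * k * k * of_nat m' * ?W (m' - 1) n'"
      by (simp only: rot.simps(2)[of k k n] wigprod_lin_left)
         (simp add: wigprod_mulX wigprod_mulY 0 derX_rot derY_rot wigprod_lin_right algebra_simps)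
    also have "\<dots> = k * x * ?W m' n' - of_nat m' * ?W (m' - 1) n'"
      by (simp add: assms(3))
    also have "\<dots> = (- 1) ^ (m' + n') * ito 0 n' (k * x) (k * y) * ito (Suc n) m' (k * x) (k * y)"
      using Suc.IH[of m' n'] Suc.IH[of "m' - 1" n'] Suc.prems
      by (cases m') (simp_all add: algebra_simps)
    finally show ?case .
  qed
next
  case (Suc m)
  have 0: "rot k k m n K q = 0" "rot k k m n q K = 0" "rot k k m' n' (Suc K) q = 0" for q
    using Suc.prems by (auto intro!: rot_eq_0)
  let ?W = "\<lambda>m' n'. wigprod K x y (rot k k m n) (rot k k m' n')"
  have "wigprod K x y (rot k k (Suc m) n) (rot k k m' n')
      = k * x * ?W m' n' - 2 * k * k * of_nat n' * ?W m' (n' - 1)"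
    by (simp only: rot.simps(3)[of k k m n] wigprod_lin_left)
       (simp add: wigprod_mulX wigprod_mulY 0 derX_rot derY_rot wigprod_lin_right algebra_simps)
  also have "\<dots> = k * x * ?W m' n' - of_nat n' * ?W m' (n' - 1)"
    by (simp add: assms(3))
  also have "\<dots> = (- 1) ^ (m' + n') * ito (Suc m) n' (k * x) (k * y) * ito n m' (k * x) (k * y)"
    using Suc.IH[of m' n'] Suc.IH[of m' "n' - 1"] Suc.prems
    by (cases n') (simp_all add: algebra_simps)
  finally show ?case .
qed

section \<open>Matrix elements in the Fock basis\<close>

lemma mmult_finite:
  assumes "finite S" "\<And>k. k \<notin> S \<Longrightarrow> A i k * B k j = 0"
  shows "mmult A B i j = (\<Sum>k\<in>S. A i k * B k j)"
proof -
  have "infsum (\<lambda>k. A i k * B k j) UNIV = infsum (\<lambda>k. A i k * B k j) S"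
    by (rule infsum_cong_neutral) (auto simp: assms(2))
  then show ?thesis using assms(1) by (simp add: mmult_def)
qed

text \<open>The k-th derivative of the column at time 0 is the column of G^k, and an entire function
  equals its Taylor series at time 1. No growth estimate on G^k is needed, and finite rows mean that
  only finite sums are differentiated.\<close>

lemma mexp_column_ODE:
  fixes G :: "'i op" and d :: "complex \<Rightarrow> 'i \<Rightarrow> complex"
  assumes fin: "\<And>i. finite (S i)" and supp: "\<And>i k. k \<notin> S i \<Longrightarrow> G i k = 0"
    and ode: "\<And>t i. ((\<lambda>t. d t i) has_field_derivative (\<Sum>k\<in>S i. G i k * d t k)) (at t)"
    and init: "\<And>i. d 0 i = mid i j"
  shows "mexp G i j = d 1 i"
proof -
  \<comment> \<open>\<open>E k\<close> is the k-th time derivative of \<open>d\<close>, written as G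
    applied k times.\<close>
  define E where "E k = ((\<lambda>f t i. \<Sum>l\<in>S i. G i l * f t l) ^^ k) d" for k
  have E0: "E 0 = d" and ES: "E (Suc k) = (\<lambda>t i. \<Sum>l\<in>S i. G i l * E k t l)" for k
    by (simp_all add: E_def)
  have deriv_E: "((\<lambda>t. E k t i) has_field_derivative E (Suc k) t i) (at t)" for k t i
  proof (induction k arbitrary: i t)
    case 0
    show ?case using ode by (simp add: E0 ES)
  next
    case (Suc k)
    have "((\<lambda>t. \<Sum>l\<in>S i. G i l * E k t l) has_field_derivative (\<Sum>l\<in>S i. G i l
        * E (Suc k) t l)) (at t)"
      by (intro DERIV_sum DERIV_cmult Suc)
    then show ?case by (simp only: ES)
  qed
  have higher: "(deriv ^^ k) (\<lambda>t. d t i) = (\<lambda>t. E k t i)" for k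
    by (induction k) (auto simp: E0 intro!: DERIV_imp_deriv deriv_E)
  have E_init: "E k 0 i = mpow G k i j" for k i
  proof (induction k arbitrary: i)
    case 0
    show ?case by (simp add: E0 init)
  next
    case (Suc k)
    have "mmult G (mpow G k) i j = (\<Sum>l\<in>S i. G i l * mpow G k l j)"
      by (rule mmult_finite[OF fin]) (simp add: supp)
    then show ?case by (simp add: ES Suc)
  qed
  have "(\<lambda>t. d t i) holomorphic_on ball 0 2"
    using ode holomorphic_on_open[of "ball 0 2"] by blast
  then have "(\<lambda>k. (deriv ^^ k) (\<lambda>t. d t i) 0 / fact k * (1 - 0) ^ k) sums d 1 i"
    by (rule holomorphic_power_series) auto
  then have "(\<lambda>k. mpow G k i j / of_nat (fact k)) sums d 1 i"
    by (simp add: higher E_init)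
  then show ?thesis
    by (simp add: mexp_def sums_iff)
qed

section \<open>Displacement operators and displaced parity\<close>

definition nrm :: "nat \<Rightarrow> complex" where
  "nrm k = complex_of_real (sqrt (fact k))"

lemma nrm_nonzero [simp]: "nrm k \<noteq> 0"
  by (simp add: nrm_def)

lemma nrm_0 [simp]: "nrm 0 = 1"
  by (simp add: nrm_def)

lemma nrm_sq: "nrm k * nrm k = fact k"
proof -
  have "nrm k * nrm k = complex_of_real (sqrt (fact k) * sqrt (fact k))"
    unfolding nrm_def by (simp only: of_real_mult)
  then show ?thesis by simp
qed

lemma nrm_Suc: "nrm (Suc k) = complex_of_real (sqrt (real (Suc k))) * nrm k"
  by (simp add: nrm_def real_sqrt_mult del: of_nat_Suc)

lemma cnj_nrm [simp]: "cnj (nrm k) = nrm k"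
  by (simp add: nrm_def)

lemma sqrt_sq_complex: "complex_of_real (sqrt (real k)) * (complex_of_real (sqrt (real k)) * z)
    = of_nat k * z"
proof -
  have "complex_of_real (sqrt (real k)) * complex_of_real (sqrt (real k)) = of_nat k"
    by (simp flip: of_real_mult)
  then show ?thesis by (simp only: mult.assoc[symmetric])
qed

lemma displ_eq:
  "displ \<alpha> i j = exp (- (\<alpha> * cnj \<alpha> / 2)) * ito i j \<alpha> (- cnj \<alpha>) / (nrm i * nrm j)"
proof -
  define G where "G = madd (mscale \<alpha> cre) (mscale (- cnj \<alpha>) ann)"
  \<comment> \<open>The column of D(t \<alpha>), continued from real to complex t: t itself is never
    conjugated, so the expression is entire.\<close>
  define d where "d t i = exp (- (t\<^sup>2 * (\<alpha> * cnj \<alpha>) / 2)) * ito i j (t * \<alpha>) (t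
      * (- cnj \<alpha>)) / (nrm i * nrm j)" for t i
  have G: "G i k = \<alpha> * (if Suc k = i then complex_of_real (sqrt (real i)) else 0)
      - cnj \<alpha> * (if Suc i = k then complex_of_real (sqrt (real k)) else 0)" for i k
    by (simp add: G_def madd_def mscale_def cre_def madj_def ann_def)
  have "mexp G i j = d 1 i"
  proof (rule mexp_column_ODE[where S = "\<lambda>i. {i - 1, Suc i}"])
    fix i k :: nat
    assume "k \<notin> {i - 1, Suc i}"
    then show "G i k = 0" by (auto simp: G)
  next
    fix t :: complex and i :: nat
    let ?e = "exp (- (t\<^sup>2 * (\<alpha> * cnj \<alpha>) / 2))"
    let ?h = "\<lambda>i j. ito i j (t * \<alpha>) (t * (- cnj \<alpha>))"
    \<comment> \<open>For i = 0 the truncated neighbour is 0 itself, and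
      \<open>G 0 0 = 0\<close>.\<close>
    have 1: "G i (i - 1) * d t (i - 1) = \<alpha> * of_nat i * ?e * ?h (i - 1) j / (nrm i * nrm j)"
    proof (cases i)
      case 0
      then show ?thesis by (simp add: G)
    next
      case (Suc i')
      then have "nrm i = complex_of_real (sqrt (real i)) * nrm i'" by (simp only: nrm_Suc)
      moreover have "complex_of_real (sqrt (real i)) \<noteq> 0" using Suc by simp
      moreover have "of_nat i = complex_of_real (sqrt (real i)) * complex_of_real (sqrt (real i))"
        using sqrt_sq_complex[of i 1] by simp
      ultimately show ?thesis using Suc by (simp add: G d_def)
    qed
    have 2: "G i (Suc i) * d t (Suc i) = - cnj \<alpha> * ?e * ?h (Suc i) j / (nrm i * nrm j)"
      by (simp add: G d_def nrm_Suc del: of_nat_Suc ito.simps)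
    have "((\<lambda>t. d t i) has_field_derivative 
       (?e * (of_nat i * \<alpha> * ?h (i - 1) j + of_nat j * (- cnj \<alpha>) * ?h i (j - 1))
         + (?e * (- (2 * t * (\<alpha> * cnj \<alpha>) / 2))) * ?h i j) / (nrm i * nrm j)) (at t)"
      unfolding d_def
      by (intro DERIV_cdivide DERIV_mult' DERIV_ito)
         (auto intro!: derivative_eq_intros)
    also have "(?e * (of_nat i * \<alpha> * ?h (i - 1) j + of_nat j * (- cnj \<alpha>) * ?h i (j - 1))
         + (?e * (- (2 * t * (\<alpha> * cnj \<alpha>) / 2))) * ?h i j) / (nrm i * nrm j)
       = \<alpha> * of_nat i * ?e * ?h (i - 1) j / (nrm i * nrm j) + - cnj \<alpha> * ?e * ?h (Suc i) j / (nrm i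
           * nrm j)"
      \<comment> \<open>The derivative of the Gaussian and the lowering of j add up to
        \<open>?h (Suc i) j\<close> by the defining recursion of \<open>ito\<close>.\<close>
      unfolding add_divide_distrib[symmetric]
      by (rule arg_cong[where f = "\<lambda>z. z / _"]) (simp add: algebra_simps)
    finally show "((\<lambda>t. d t i) has_field_derivative (\<Sum>k\<in>{i - 1, Suc i}. G i k * d t k)) (at t)"
      using 1 2 by simp
  next
    fix i show "d 0 i = mid i j"
    proof -
      have "ito i j 0 (0::complex) = (if i = j then fact i else 0)"
        by (induction i arbitrary: j) (auto simp: fact_reduce)
      then show ?thesis by (simp add: d_def mid_def nrm_sq)
    qed
  qed auto
  then show ?thesis by (simp add: displ_def G_def d_def)
qed

text \<open>Conjugation exchanges the arguments up to sign; for \<open>displ\<close> this says that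
  the adjoint of D(a) is D(-a), its parity conjugate.\<close>

lemma cnj_ito_conj: "cnj (ito i j a (- cnj a)) = (- 1) ^ (i + j) * ito j i a (- cnj a)"
proof -
  have "ito i j (cnj a) (- a) = ito j i (- a) (- (- cnj a))"
    using ito_swap[of i j "cnj a" "- a"] by simp
  also have "\<dots> = (- 1) ^ (i + j) * ito j i a (- cnj a)"
    by (simp only: ito_minus add.commute)
  finally show ?thesis by (simp add: cnj_ito)
qed

lemma cnj_displ:
  "cnj (displ \<alpha> i j) = (- 1) ^ (i + j) * displ \<alpha> j i"
  using cnj_ito_conj[of i j \<alpha>] by (simp add: displ_eq exp_cnj mult_ac)

text \<open>Parity reverses displacements, so D(a) P D(a)^dagger = D(2a) P; this explains the
  doubled arguments and the Gaussian exp(-|2a|^2 / 2).\<close>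

lemma dparity_eq:
  "dparity \<alpha> i j = (- 1) ^ j * exp (- (2 * (\<alpha> * cnj \<alpha>))) * ito i j (2 * \<alpha>) (- (2
      * cnj \<alpha>)) / (nrm i * nrm j)"
proof -
  have 1: "mmult (displ \<alpha>) parity i k = displ \<alpha> i k * (- 1) ^ k" for k
    by (subst mmult_finite[where S = "{k}"]) (auto simp: parity_def)
  let ?c = "(- 1) ^ j * exp (- (\<alpha> * cnj \<alpha>)) / (nrm i * nrm j)"
  have 2: "displ \<alpha> i k * (- 1) ^ k * cnj (displ \<alpha> j k)
     = ?c * (ito i k \<alpha> (- cnj \<alpha>) * ito k j \<alpha> (- cnj \<alpha>) / fact k)" for k
  proof -
    have "exp (- (\<alpha> * cnj \<alpha> / 2)) * exp (- (\<alpha> * cnj \<alpha> / 2)) = exp (- (\<alpha> * cnj \<alpha>))"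
      by (simp flip: exp_add)
    note e = this[symmetric]
    have "displ \<alpha> i k * displ \<alpha> k j = exp (- (\<alpha> * cnj \<alpha>)) * (ito i k \<alpha> (- cnj \<alpha>)
        * ito k j \<alpha> (- cnj \<alpha>)) / (nrm i * nrm j * (nrm k * nrm k))"
      unfolding e by (simp add: displ_eq mult_ac)
    \<comment> \<open>The sign of parity and the sign from conjugating \<open>displ\<close> cancel
      in k, so the sum has the form of \<open>ito_has_sum\<close>.\<close>
    moreover have "(- 1) ^ k * (- 1) ^ (j + k) = ((- 1) ^ j :: complex)"
      by (simp add: power_add)
    moreover have "displ \<alpha> i k * (- 1) ^ k * cnj (displ \<alpha> j k)
        = ((- 1) ^ k * (- 1) ^ (j + k)) * (displ \<alpha> i k * displ \<alpha> k j)"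
      by (simp only: cnj_displ mult_ac)
    ultimately show ?thesis
      by (simp add: nrm_sq mult_ac)
  qed
  have "((\<lambda>k. ?c * (ito i k \<alpha> (- cnj \<alpha>) * ito k j \<alpha> (- cnj \<alpha>) / fact k)) has_sum
     ?c * (exp (- cnj \<alpha> * \<alpha>) * ito i j (\<alpha> + \<alpha>) (- cnj \<alpha> + - cnj \<alpha>))) UNIV"
    by (intro has_sum_cmult_right ito_has_sum)
  then have "dparity \<alpha> i j = ?c * (exp (- cnj \<alpha> * \<alpha>) * ito i j (\<alpha> + \<alpha>) (- cnj \<alpha> + - cnj \<alpha>))"
    unfolding dparity_def by (subst mmult_def) (simp add: 1 2 madj_def infsumI)
  also have "\<dots> = (- 1) ^ j * (exp (- (\<alpha> * cnj \<alpha>)) * exp (- (\<alpha> * cnj \<alpha>))) * ito i j (2 * \<alpha>) (- (2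
      * cnj \<alpha>)) / (nrm i * nrm j)"
    by (simp add: mult_ac flip: mult_2)
  also have "exp (- (\<alpha> * cnj \<alpha>)) * exp (- (\<alpha> * cnj \<alpha>)) = exp (- (2 * (\<alpha> * cnj \<alpha>)))"
    by (simp flip: exp_add)
  finally show ?thesis .
qed

section \<open>The beam-splitter matrix\<close>

lemma DERIV_rot:
  fixes t :: complex
  shows "((\<lambda>t. rot (cos t) (sin t) m n p q) has_field_derivative
     lin (- of_nat m) (rot (cos t) (sin t) (m - 1) (Suc n)) (of_nat n) (rot (cos t) (sin t) (Suc
         m) (n - 1)) p q) (at t)"
proof -
  have mulX: "((\<lambda>t. mulX (R t) p q) has_field_derivative mulX R' p q) (at t)"
    and mulY: "((\<lambda>t. mulY (R t) p q) has_field_derivative mulY R' p q) (at t)"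
    if "\<And>p q. ((\<lambda>t. R t p q) has_field_derivative R' p q) (at t)" for R R' p q
    using that by (auto simp: mulX_def mulY_def)
  show ?thesis
  proof (induction m arbitrary: p q)
    case 0
    show ?case
    proof (induction n arbitrary: p q)
      case 0
      show ?case by (simp add: lin_def)
    next
      case (Suc n)
      let ?R = "\<lambda>t. rot (cos t) (sin t)"
      let ?R' = "lin (- of_nat 0) (?R t (0 - 1) (Suc n)) (of_nat n) (?R t (Suc 0) (n - 1))"
      have "((\<lambda>t. sin t * mulX (?R t 0 n) p q + cos t * mulY (?R t 0 n) p q) has_field_derivative
         (sin t * mulX ?R' p q + cos t * mulX (?R t 0 n) p q)
         + (cos t * mulY ?R' p q + - sin t * mulY (?R t 0 n) p q)) (at t)"
        by (intro DERIV_add DERIV_mult' DERIV_sin DERIV_cos mulX mulY Suc.IH)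
      also have "(sin t * mulX ?R' p q + cos t * mulX (?R t 0 n) p q)
         + (cos t * mulY ?R' p q + - sin t * mulY (?R t 0 n) p q)
         = ?R t 1 n p q + of_nat n * ?R t 1 (Suc (n - 1)) p q"
        unfolding rot_Suc_right by (simp add: mulX_lin mulY_lin) (simp add: lin_def algebra_simps)
      also have "\<dots> = lin (- of_nat 0) (?R t (0 - 1) (Suc (Suc n))) (of_nat (Suc n)) (?R t (Suc 0)
          (Suc n - 1)) p q"
        by (cases n) (simp_all add: lin_def algebra_simps)
      finally show ?case by (simp add: lin_def[of "sin _"])
    qed
  next
    case (Suc m)
    let ?R = "\<lambda>t. rot (cos t) (sin t)"
    let ?R' = "lin (- of_nat m) (?R t (m - 1) (Suc n)) (of_nat n) (?R t (Suc m) (n - 1))"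
    have "((\<lambda>t. cos t * mulX (?R t m n) p q + (- sin t) * mulY (?R t m n) p q) has_field_derivative
       (cos t * mulX ?R' p q + - sin t * mulX (?R t m n) p q)
       + ((- sin t) * mulY ?R' p q + - cos t * mulY (?R t m n) p q)) (at t)"
      by (intro DERIV_add DERIV_mult' DERIV_minus DERIV_sin DERIV_cos mulX mulY Suc.IH)
    also have "(cos t * mulX ?R' p q + - sin t * mulX (?R t m n) p q)
       + ((- sin t) * mulY ?R' p q + - cos t * mulY (?R t m n) p q)
       = - ?R t m (Suc n) p q - of_nat m * ?R t (Suc (m - 1)) (Suc n) p q + of_nat n
           * ?R t (Suc (Suc m)) (n - 1) p q"
      unfolding rot_Suc_right[of "cos t" "sin t" m n] rot.simps(3)[of _ _ "m - 1"] rot.simps(3)[of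
          _ _ "Suc m"] 
      by (simp add: mulX_lin mulY_lin del: rot.simps) (simp add: lin_def algebra_simps del:
          rot.simps)
    also have "\<dots> = lin (- of_nat (Suc m)) (?R t (Suc m - 1) (Suc n)) (of_nat n) (?R t (Suc (Suc
        m)) (n - 1)) p q"
      by (cases m) (simp_all add: lin_def algebra_simps del: rot.simps)
    finally show ?case by (simp add: lin_def[of "cos _"])
  qed
qed

text \<open>The generator is (pi/4)(X d/dY - Y d/dX), an infinitesimal rotation, so column (m, n) is
  X^m Y^n with the variables rotated by pi/4. The \<open>nrm\<close> factors pass from monomials to
  normalised Fock states.\<close>

lemma bs_half_eq:
  "bs_half (p, q) (m, n) =
    rot (complex_of_real (sqrt 2 / 2)) (complex_of_real (sqrt 2 / 2)) m n p q * (nrm p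
        * nrm q) / (nrm m * nrm n)"
proof -
  define G where "G = mscale (complex_of_real (pi / 4))
      (madd (mmult (on1 cre) (on2 ann)) (mscale (-1) (mmult (on1 ann) (on2 cre))))"
  let ?c = "complex_of_real (pi / 4)"
  have *: "mmult (on1 A) (on2 B) (p, q) (p', q') = A p p' * B q q'" for A B p q p' q'
    by (subst mmult_finite[where S = "{(p', q)}"]) (auto simp: on1_def on2_def split: if_splits)
  define d where "d t pq = rot (cos (t * ?c)) (sin (t * ?c)) m n (fst pq) (snd pq)
     * (nrm (fst pq) * nrm (snd pq)) / (nrm m * nrm n)" for t pq
  have G: "G (p, q) (p', q') = ?c * (cre p p' * ann q q' - ann p p' * cre q q')" for p q p' q'
    by (simp add: G_def mscale_def madd_def *)
  have "mexp G (p, q) (m, n) = d 1 (p, q)"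
  proof (rule mexp_column_ODE[where S = "\<lambda>(p, q). {(p - 1, Suc q), (Suc p, q - 1)}"])
    fix i k :: "nat \<times> nat"
    assume "k \<notin> (case i of (p, q) \<Rightarrow> {(p - 1, Suc q), (Suc p, q - 1)})"
    then show "G i k = 0"
      by (cases i; cases k) (auto simp: G cre_def ann_def madj_def)
  next
    fix i :: "nat \<times> nat" show "finite (case i of (p, q) \<Rightarrow> {(p - 1, Suc q), (Suc p, q - 1)})"
      by (cases i) auto
  next
    fix i :: "nat \<times> nat" show "d 0 i = mid i (m, n)"
      by (cases i) (auto simp: d_def rot_one_zero mid_def)
  next
    fix t :: complex and i :: "nat \<times> nat"
    obtain p q where i: "i = (p, q)" by (cases i)
    let ?R = "rot (cos (t * ?c)) (sin (t * ?c)) m n"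
    let ?N = "nrm p * nrm q / (nrm m * nrm n)"
    have 1: "G i (p - 1, Suc q) * d t (p - 1, Suc q) = ?c * mulX (derY ?R) p q * ?N"
    proof (cases p)
      case 0
      then show ?thesis by (simp add: G i cre_def ann_def madj_def mulX_def)
    next
      case (Suc p')
      have "complex_of_real (sqrt (real (Suc q))) * (complex_of_real (sqrt (real (Suc q))) * z)
          = of_nat (Suc q) * z" for z
        by (rule sqrt_sq_complex)
      then show ?thesis using Suc
        by (simp add: G i cre_def ann_def madj_def mulX_def derY_def d_def nrm_Suc mult_ac del:
            of_nat_Suc)
    qed
    have 2: "G i (Suc p, q - 1) * d t (Suc p, q - 1) = - ?c * mulY (derX ?R) p q * ?N"
    proof (cases q)
      case 0
      then show ?thesis by (simp add: G i cre_def ann_def madj_def mulY_def)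
    next
      case (Suc q')
      have "complex_of_real (sqrt (real (Suc p))) * (complex_of_real (sqrt (real (Suc p))) * z)
          = of_nat (Suc p) * z" for z
        by (rule sqrt_sq_complex)
      then show ?thesis using Suc
        by (simp add: G i cre_def ann_def madj_def mulY_def derX_def d_def nrm_Suc mult_ac del:
            of_nat_Suc)
    qed
    have "((\<lambda>t. rot (cos (t * ?c)) (sin (t * ?c)) m n p q) has_field_derivative
       lin 1 (mulX (derY ?R)) (- 1) (mulY (derX ?R)) p q * ?c) (at t)"
      unfolding generator_rot
      by (rule DERIV_chain2[OF DERIV_rot]) (auto intro!: derivative_eq_intros)
    then have "((\<lambda>t. d t i) has_field_derivative
       lin 1 (mulX (derY ?R)) (- 1) (mulY (derX ?R)) p q * ?c * (nrm p * nrm q) / (nrm m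
           * nrm n)) (at t)"
      unfolding d_def i fst_conv snd_conv by (intro DERIV_cdivide DERIV_cmult_right)
    also have "lin 1 (mulX (derY ?R)) (- 1) (mulY (derX ?R)) p q * ?c * (nrm p * nrm q) / (nrm m
        * nrm n)
       = G i (p - 1, Suc q) * d t (p - 1, Suc q) + G i (Suc p, q - 1) * d t (Suc p, q - 1)"
      unfolding 1 2 by (simp add: lin_def algebra_simps add_divide_distrib diff_divide_distrib)
    also have "\<dots> = (\<Sum>k\<in>(case i of (p, q) \<Rightarrow> {(p - 1, Suc q), (Suc p, q - 1)}). G i k * d t k)"
      by (simp add: i)
    finally show "((\<lambda>t. d t i) has_field_derivative
       (\<Sum>k\<in>(case i of (p, q) \<Rightarrow> {(p - 1, Suc q), (Suc p, q - 1)}). G i k * d t k)) (at t)" .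
  qed
  moreover have "cos ?c = complex_of_real (sqrt 2 / 2)" "sin ?c = complex_of_real (sqrt 2 / 2)"
    by (simp_all only: cos_of_real sin_of_real cos_45 sin_45)
  moreover have "bs_half = mexp G" by (simp only: bs_half_def G_def)
  ultimately show ?thesis
    by (simp only: d_def fst_conv snd_conv mult_1)
qed

section \<open>The Wigner function of the beam-splitter state\<close>

lemma rot_of_real:
  "rot (complex_of_real c) (complex_of_real s) m n p q = complex_of_real (rot c s m n p q)"
proof (induction m arbitrary: p q)
  case 0
  show ?case
    by (induction n arbitrary: p q) (auto simp: lin_def mulX_def mulY_def)
next
  case (Suc m)
  then show ?case by (auto simp: lin_def mulX_def mulY_def)
qed

lemma sum_single:
  assumes "finite A" "a \<in> A" "\<And>x. x \<in> A \<Longrightarrow> x \<noteq> a \<Longrightarrow> f x = 0"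
  shows "sum f A = f a"
  using sum.mono_neutral_right[of A "{a}" f] assms by auto

text \<open>Probability of finding i photons in the first output mode, hence m + n - i in the
  second.\<close>

definition bs_weight :: "nat \<Rightarrow> nat \<Rightarrow> nat \<Rightarrow> real" where
  "bs_weight m n i = (rot (sqrt 2 / 2) (sqrt 2 / 2) m n i (m + n - i))\<^sup>2
     * (fact i * fact (m + n - i)) / (fact m * fact n)"

text \<open>By photon-number conservation the traced-out number q determines the number in the first
  mode, so no coherences survive.\<close>

lemma bs_state_eq:
  "bs_state m n i j = (if i = j \<and> i \<le> m + n then complex_of_real (bs_weight m n i) else 0)"
proof -
  let ?U = "\<lambda>x. bs_half x (m, n)"
  let ?R = "rot (sqrt 2 / 2) (sqrt 2 / 2) m n"
  have 1: "mmult bs_half (tensor (proj m) (proj n)) x y = (if y = (m, n) then ?U x else 0)" for x y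
    by (subst mmult_finite[where S = "{(m, n)}"])
       (auto simp: tensor_def proj_def split: if_splits prod.splits)
  have 2: "mmult (mmult bs_half (tensor (proj m) (proj n))) (madj bs_half) x y
      = ?U x * cnj (?U y)" for x y
    by (subst mmult_finite[where S = "{(m, n)}"]) (auto simp: 1 madj_def split: if_splits)
  have U: "?U (p, q) = complex_of_real (?R p q) * (nrm p * nrm q) / (nrm m * nrm n)" for p q
    by (simp only: bs_half_eq rot_of_real)
  have U0: "?U (p, q) = 0" if "p + q \<noteq> m + n" for p q
    using that by (simp add: U rot_eq_0)
  have bs: "bs_state m n i j = infsum (\<lambda>q. ?U (i, q) * cnj (?U (j, q))) UNIV"
    by (simp add: bs_state_def ptrace2_def 2)
  show ?thesis
  proof (cases "i \<le> m + n")
    case False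
    then have "?U (i, q) = 0" for q by (intro U0) auto
    then show ?thesis using False by (simp add: bs)
  next
    case True
    define q where "q = m + n - i"
    have "bs_state m n i j = infsum (\<lambda>q. ?U (i, q) * cnj (?U (j, q))) {q}"
      unfolding bs
    proof (rule infsum_cong_neutral)
      fix q' assume "q' \<in> UNIV - {q}"
      then have "?U (i, q') = 0" by (intro U0) (use True in \<open>auto simp: q_def\<close>)
      then show "?U (i, q') * cnj (?U (j, q')) = 0" by simp
    qed auto
    then have "bs_state m n i j = ?U (i, q) * cnj (?U (j, q))" by simp
    also have "\<dots> = (if i = j then complex_of_real (bs_weight m n i) else 0)"
    proof (cases "i = j")
      case True
      have "?U (i, q) * cnj (?U (i, q)) = complex_of_real ((?R i q)\<^sup>2)
          * ((nrm i * nrm i) * (nrm q * nrm q)) / ((nrm m * nrm m) * (nrm n * nrm n))"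
        by (simp add: U power2_eq_square mult_ac)
      then show ?thesis using True by (simp add: nrm_sq bs_weight_def q_def)
    next
      case False
      then have "?U (j, q) = 0" by (intro U0) (use \<open>i \<le> m + n\<close> in \<open>auto simp: q_def\<close>)
      then show ?thesis using False by simp
    qed
    finally show ?thesis using True by simp
  qed
qed

lemma bs_weight_nonneg: "bs_weight m n i \<ge> 0"
  by (simp add: bs_weight_def)

lemma bs_weight_top: "bs_weight m n (m + n) > 0"
  by (simp add: bs_weight_def rot_right_0)

lemma half_sqrt2: "2 * complex_of_real (sqrt 2 / 2) * complex_of_real (sqrt 2 / 2) = 1"
  by (simp flip: of_real_mult)

lemma sum_bs_weight: "(\<Sum>i\<le>m + n. bs_weight m n i) = 1"
proof -
  let ?k = "complex_of_real (sqrt 2 / 2)"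
  let ?R = "rot ?k ?k m n"
  have "complex_of_real (\<Sum>i\<le>m + n. bs_weight m n i)
      = (\<Sum>p\<le>m + n. ?R p (m + n - p) * (?R p (m + n - p) * fact p * fact (m + n - p))) / (fact m
          * fact n)"
    unfolding rot_of_real bs_weight_def
    by (simp add: sum_divide_distrib power2_eq_square mult_ac)
  also have "(\<Sum>p\<le>m + n. ?R p (m + n - p) * (?R p (m + n - p) * fact p * fact (m + n - p)))
      = fockprod (m + n) ?R ?R"
    unfolding fockprod_def
    by (rule sum.cong[OF refl], rule sum_single[symmetric]) (auto simp: rot_eq_0)
  also have "\<dots> = fact m * fact n"
    using half_sqrt2 by (intro fockprod_rot) (auto simp: power2_eq_square)
  finally have "complex_of_real (\<Sum>i\<le>m + n. bs_weight m n i) = 1" by simp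
  then show ?thesis by (simp only: of_real_eq_1_iff)
qed

text \<open>The Wigner function of a matrix supported on \<open>{..N}\<close>, without its Gaussian factor.\<close>
definition wig_sum :: "nat \<Rightarrow> nat op \<Rightarrow> complex \<Rightarrow> complex" where
  "wig_sum N A \<alpha> = (\<Sum>i\<le>N. \<Sum>j\<le>N. A i j * ((- 1) ^ i * ito j i (2 * \<alpha>) (- (2 * cnj \<alpha>)) / (nrm j
      * nrm i)))"

lemma wigner_eq:
  assumes "\<And>i j. i > N \<or> j > N \<Longrightarrow> A i j = 0"
  shows "wigner A \<alpha> = complex_of_real (2 / pi * exp (- (2 * (cmod \<alpha>)\<^sup>2))) * wig_sum N A \<alpha>"
proof -
  have 1: "mmult A (dparity \<alpha>) i i = (\<Sum>j\<le>N. A i j * dparity \<alpha> j i)" for i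
    by (rule mmult_finite) (auto simp: assms)
  have "mtrace (mmult A (dparity \<alpha>)) = infsum (\<lambda>i. \<Sum>j\<le>N. A i j * dparity \<alpha> j i) {..N}"
    unfolding mtrace_def 1 by (rule infsum_cong_neutral) (auto simp: assms)
  also have "\<dots> = (\<Sum>i\<le>N. \<Sum>j\<le>N. A i j * dparity \<alpha> j i)"
    by simp
  also have "\<dots> = exp (- (2 * (\<alpha> * cnj \<alpha>))) * wig_sum N A \<alpha>"
    by (simp add: dparity_eq wig_sum_def sum_distrib_left mult_ac)
  also have "- (2 * (\<alpha> * cnj \<alpha>)) = complex_of_real (- (2 * (cmod \<alpha>)\<^sup>2))"
    by (simp only: complex_norm_square of_real_minus of_real_mult of_real_numeral)
  also note exp_of_real
  finally show ?thesis by (simp add: wigner_def)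
qed

text \<open>The function H of the overview; the scale sqrt 2 is the doubled argument of displaced
  parity times the beam-splitter coefficient sqrt 2 / 2.\<close>

definition bs_amp :: "nat \<Rightarrow> nat \<Rightarrow> complex \<Rightarrow> complex" where
  "bs_amp m n \<alpha> = ito m n (complex_of_real (sqrt 2) * \<alpha>) (- (complex_of_real (sqrt 2) * cnj \<alpha>))"

lemma wig_sum_bs_state:
  "wig_sum (m + n) (bs_state m n) \<alpha> = complex_of_real ((cmod (bs_amp m n \<alpha>))\<^sup>2 / (fact m * fact n))"
proof -
  let ?k = "complex_of_real (sqrt 2 / 2)"
  let ?R = "rot ?k ?k m n"
  let ?K = "m + n"
  let ?x = "2 * \<alpha>" let ?y = "- (2 * cnj \<alpha>)"
  let ?F = "\<lambda>p p' q. ?R p q * (?R p' q * fact q * (- 1) ^ p' * ito p p' ?x ?y)"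
  have "wigprod ?K ?x ?y ?R ?R = (\<Sum>p'\<le>?K. \<Sum>p\<le>?K. \<Sum>q\<le>?K. ?F p p' q)"
    by (rule wigprod_swap)
  \<comment> \<open>Homogeneity of both arguments forces q = m + n - p and p' = p, which is exactly
    the diagonal sum for the state.\<close>
  also have "\<dots> = (\<Sum>p\<le>?K. ?F p p (?K - p))"
  proof (rule sum.cong[OF refl])
    fix p' assume p': "p' \<in> {..?K}"
    have "(\<Sum>p\<le>?K. \<Sum>q\<le>?K. ?F p p' q) = (\<Sum>q\<le>?K. ?F p' p' q)"
    proof (rule sum_single)
      fix p assume p: "p \<in> {..?K}" "p \<noteq> p'"
      show "(\<Sum>q\<le>?K. ?F p p' q) = 0"
      proof (rule sum.neutral, rule ballI)
        fix q
        have "?R p q = 0 \<or> ?R p' q = 0"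
          using p rot_eq_0[of p q m n] rot_eq_0[of p' q m n] by (cases "p + q = m + n") auto
        then show "?F p p' q = 0" by auto
      qed
    qed (use p' in auto)
    also have "\<dots> = ?F p' p' (?K - p')"
      by (rule sum_single) (use p' in \<open>auto simp: rot_eq_0\<close>)
    finally show "(\<Sum>p\<le>?K. \<Sum>q\<le>?K. ?F p p' q) = ?F p' p' (?K - p')" .
  qed
  finally have 1: "wigprod ?K ?x ?y ?R ?R = (\<Sum>p\<le>?K. ?F p p (?K - p))" .
  have "wig_sum ?K (bs_state m n) \<alpha>
      = (\<Sum>i\<le>?K. complex_of_real (bs_weight m n i) * ((- 1) ^ i * ito i i ?x ?y / fact i))"
    unfolding wig_sum_def
  proof (rule sum.cong[OF refl])
    fix i assume i: "i \<in> {..?K}"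
    have "(\<Sum>j\<le>?K. bs_state m n i j * ((- 1) ^ i * ito j i ?x ?y / (nrm j * nrm i)))
       = bs_state m n i i * ((- 1) ^ i * ito i i ?x ?y / (nrm i * nrm i))"
      by (rule sum_single) (use i in \<open>auto simp: bs_state_eq\<close>)
    then show "(\<Sum>j\<le>?K. bs_state m n i j * ((- 1) ^ i * ito j i ?x ?y / (nrm j * nrm i)))
       = complex_of_real (bs_weight m n i) * ((- 1) ^ i * ito i i ?x ?y / fact i)"
      using i by (simp add: bs_state_eq nrm_sq)
  qed
  also have "\<dots> = (\<Sum>p\<le>?K. ?F p p (?K - p)) / (fact m * fact n)"
    unfolding rot_of_real bs_weight_def
    by (simp add: sum_divide_distrib power2_eq_square mult_ac)
  also have "\<dots> = (- 1) ^ (m + n) * ito m n (?k * ?x) (?k * ?y) * ito n m (?k * ?x) (?k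
      * ?y) / (fact m * fact n)"
    unfolding 1[symmetric] by (subst wigprod_rot) (use half_sqrt2 in auto)
  also have "?k * ?x = complex_of_real (sqrt 2) * \<alpha>" by simp
  also have "?k * ?y = - cnj (complex_of_real (sqrt 2) * \<alpha>)" by simp
  \<comment> \<open>The two factors from \<open>wigprod_rot\<close> are conjugate up to this sign,
    which gives the square.\<close>
  also have "(- 1) ^ (m + n) * ito m n (complex_of_real (sqrt 2)
      * \<alpha>) (- cnj (complex_of_real (sqrt 2) * \<alpha>))
       * ito n m (complex_of_real (sqrt 2) * \<alpha>) (- cnj (complex_of_real (sqrt 2) * \<alpha>))
     = bs_amp m n \<alpha> * cnj (bs_amp m n \<alpha>)"
    using cnj_ito_conj[of m n "complex_of_real (sqrt 2) * \<alpha>"] by (simp add: bs_amp_def mult_ac)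
  also have "\<dots> = complex_of_real ((cmod (bs_amp m n \<alpha>))\<^sup>2)"
    by (simp only: complex_norm_square)
  finally show ?thesis by simp
qed

section \<open>Real-rootedness\<close>

text \<open>The logarithmic derivative is the sum of \<open>1 / (z - a)\<close> over the roots, so off the half-line
  containing the roots it never equals \<open>1\<close>.\<close>
lemma log_deriv_sign:
  fixes p :: "complex poly"
  assumes "p \<noteq> 0" "\<And>a. poly p a = 0 \<Longrightarrow> a \<in> \<real>\<^sub>\<ge>\<^sub>0" "z \<notin> \<real>\<^sub>\<ge>\<^sub>0"
  shows "\<exists>w. poly (pderiv p) z = w * poly p z \<and>
     (w = 0 \<or> Im w * Im z < 0 \<or> (Im z = 0 \<and> Re w < 0))"
  using assms(1,2)
proof (induction "degree p" arbitrary: p rule: less_induct)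
  case (less p)
  show ?case
  proof (cases "degree p = 0")
    case True
    then have "pderiv p = 0" by (simp add: pderiv_eq_0_iff)
    then show ?thesis by auto
  next
    case False
    then obtain a where a: "poly p a = 0"
      using Fundamental_Theorem_Algebra.fundamental_theorem_of_algebra[of p] constant_degree[of p]
          by auto
    then obtain q where q: "p = [:- a, 1:] * q"
      by (auto simp: poly_eq_0_iff_dvd)
    then have "q \<noteq> 0" using less.prems by auto
    then have "degree q < degree p" unfolding q by (subst degree_mult_eq) auto
    moreover have "b \<in> \<real>\<^sub>\<ge>\<^sub>0" if "poly q b = 0" for b
      using that less.prems(2)[of b] by (simp add: q)
    ultimately obtain w where w: "poly (pderiv q) z = w * poly q z"
      "w = 0 \<or> Im w * Im z < 0 \<or> (Im z = 0 \<and> Re w < 0)"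
      using less.hyps[of q] \<open>q \<noteq> 0\<close> by blast
    obtain r where r: "a = complex_of_real r" "r \<ge> 0"
      using less.prems(2)[OF a] by (auto elim: nonneg_Reals_cases)
    have za: "z \<noteq> a" using less.prems(2)[OF a] assms(3) by auto
    define u where "u = inverse (z - a)"
    have "poly (pderiv p) z = poly q z + (z - a) * poly (pderiv q) z"
      unfolding q pderiv_mult by (simp add: pderiv_pCons algebra_simps)
    also have "\<dots> = (u + w) * poly p z"
      using za by (simp add: q w(1) u_def field_simps)
    finally have 1: "poly (pderiv p) z = (u + w) * poly p z" .
    have n0: "(Re z - r)\<^sup>2 + (Im z)\<^sup>2 > 0"
      using za r by (auto simp: complex_eq_iff sum_power2_gt_zero_iff)
    have Im: "Im u = - Im z / ((Re z - r)\<^sup>2 + (Im z)\<^sup>2)"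
      and Re: "Re u = (Re z - r) / ((Re z - r)\<^sup>2 + (Im z)\<^sup>2)"
      by (simp_all add: u_def r)
    have "Im (u + w) * Im z < 0 \<or> (Im z = 0 \<and> Re (u + w) < 0)"
    proof (cases "Im z = 0")
      case True
      then have "Re z < 0" using assms(3) by (auto simp: complex_nonneg_Reals_iff)
      then have "Re u < 0" using n0 r unfolding Re by (intro divide_neg_pos) auto
      then show ?thesis using w(2) True by auto
    next
      case False
      have "Im u * Im z = - ((Im z)\<^sup>2 / ((Re z - r)\<^sup>2 + (Im z)\<^sup>2))"
        unfolding Im by (simp add: power2_eq_square)
      also have "\<dots> < 0" using n0 False by simp
      finally show ?thesis using w(2) False by (auto simp: algebra_simps)
    qed
    then show ?thesis using 1 by blast
  qed
qed

text \<open>A root of p' - p off the half-line would make the logarithmic derivative equal to 1,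
  which \<open>log_deriv_sign\<close> excludes.\<close>

lemma pderiv_diff_roots:
  fixes p :: "complex poly"
  assumes "p \<noteq> 0" "\<And>a. poly p a = 0 \<Longrightarrow> a \<in> \<real>\<^sub>\<ge>\<^sub>0"
  shows "pderiv p - p \<noteq> 0" "\<And>z. poly (pderiv p - p) z = 0 \<Longrightarrow> z \<in> \<real>\<^sub>\<ge>\<^sub>0"
proof -
  show "pderiv p - p \<noteq> 0"
  proof
    assume "pderiv p - p = 0"
    then have *: "pderiv p = p" by simp
    then have "degree p - 1 = degree p" using degree_pderiv[of p] by simp
    then have "degree p = 0" by simp
    then have "pderiv p = 0" by (simp add: pderiv_eq_0_iff)
    with * assms(1) show False by simp
  qed
  fix z assume z: "poly (pderiv p - p) z = 0"
  show "z \<in> \<real>\<^sub>\<ge>\<^sub>0"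
  proof (rule ccontr)
    assume "z \<notin> \<real>\<^sub>\<ge>\<^sub>0"
    moreover from this have "poly p z \<noteq> 0" using assms(2) by blast
    ultimately show False
      using log_deriv_sign[OF assms, of z] z by auto
  qed
qed

lemma pderiv_ito: "pderiv (ito m n [:0, 1:] [:c:]) = of_nat m * ito (m - 1) n [:0, 1:] [:c:]"
proof (induction m arbitrary: n)
  case 0
  have "[:c:] ^ n = [:c ^ n:]" by (induction n) auto
  then show ?case by (simp add: pderiv_pCons)
next
  case (Suc m)
  have *: "of_nat m * ito m n [:0, 1:] [:c:] = of_nat m * ([:0, 1:] * ito (m - 1) n [:0, 1:] [:c:]
      + of_nat n * ito (m - 1) (n - 1) [:0, 1:] [:c:])"
    by (cases m) simp_all
  have "pderiv (ito (Suc m) n [:0, 1:] [:c:])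
      = ito m n [:0, 1:] [:c:] + of_nat m * ([:0, 1:] * ito (m - 1) n [:0, 1:] [:c:]
      + of_nat n * ito (m - 1) (n - 1) [:0, 1:] [:c:])"
    by (simp only: ito.simps pderiv_add pderiv_mult Suc.IH pderiv_of_nat pderiv_pCons)
       (simp add: algebra_simps flip: one_pCons del: mult_pCons_left mult_pCons_right)
  then show ?case unfolding *[symmetric] by (simp add: algebra_simps del: ito.simps)
qed

text \<open>With second argument -1, raising n is exactly p -> p' - p, and n = 0 gives x^m. Up to
  sign and powers of x these are Laguerre polynomials.\<close>

lemma ito_poly_roots:
  "ito m n [:0, 1:] [:- 1:] \<noteq> (0 :: complex poly)"
  "poly (ito m n [:0, 1:] [:- 1:]) z = (0::complex) \<Longrightarrow> z \<in> \<real>\<^sub>\<ge>\<^sub>0"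
proof -
  have "ito m n [:0, 1:] [:- 1:] \<noteq> (0 :: complex poly) \<and>
    (\<forall>z::complex. poly (ito m n [:0, 1:] [:- 1:]) z = 0 \<longrightarrow> z \<in> \<real>\<^sub>\<ge>\<^sub>0)"
  proof (induction n)
    case 0
    show ?case by (auto simp: ito_0_right)
  next
    case (Suc n)
    let ?p = "ito m n [:0, 1:] [:- 1:] :: complex poly"
    have "ito m (Suc n) [:0, 1:] [:- 1:] = pderiv ?p - ?p"
      unfolding pderiv_ito ito_Suc_right by simp
    then show ?case using pderiv_diff_roots[of ?p] Suc by metis
  qed
  then show "ito m n [:0, 1:] [:- 1:] \<noteq> (0 :: complex poly)"
    "poly (ito m n [:0, 1:] [:- 1:]) z = (0::complex) \<Longrightarrow> z \<in> \<real>\<^sub>\<ge>\<^sub>0" by auto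
qed

lemma ito_antidiagonal_real_roots:
  fixes s :: complex
  assumes "ito m n s (- s) = 0"
  shows "s \<in> \<real>"
proof (cases "s = 0")
  case False
  have "s ^ n * ito m n (s * s) (- 1) = s ^ m * ito m n s (- s)"
    using ito_scale[of s n m s "- 1"] by simp
  then have "ito m n (s * s) (- 1) = 0" using assms False by simp
  then have "s * s \<in> \<real>\<^sub>\<ge>\<^sub>0"
    by (intro ito_poly_roots(2)[of m n]) (simp add: poly_ito)
  then obtain r where r: "s * s = complex_of_real r" "r \<ge> 0"
    by (auto elim: nonneg_Reals_cases)
  have "complex_of_real (sqrt r) * complex_of_real (sqrt r) = complex_of_real r"
    using r(2) by (simp flip: of_real_mult)
  then have "s * s = complex_of_real (sqrt r) * complex_of_real (sqrt r)"
    using r(1) by simp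
  then have "s = complex_of_real (sqrt r) \<or> s = complex_of_real (- sqrt r)"
    by (simp only: square_eq_iff of_real_minus)
  then show ?thesis by (auto simp del: of_real_minus)
qed auto

text \<open>At a root of \<open>q\<close> the bound forces a root of \<open>p\<close>; cancel the
  common factor and repeat. The bound is lost at the cancelled point, hence the finite exceptional
  set \<open>F\<close>.\<close>

lemma real_rooted_dvd:
  fixes p q :: "complex poly"
  assumes "q \<noteq> 0" "\<And>z. poly q z = 0 \<Longrightarrow> z \<in> \<real>" "finite F"
    "\<And>r. r \<notin> F \<Longrightarrow> cmod (poly p (complex_of_real r)) \<le> C * cmod (poly q (complex_of_real r))"
  shows "q dvd p"
  using assms
proof (induction "degree q" arbitrary: p q F rule: less_induct)
  case (less q p F)
  show ?case
  proof (cases "degree q = 0")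
    case True
    then show ?thesis using less.prems(1) is_unit_iff_degree dvd_trans one_dvd by metis
  next
    case False
    then obtain a where a: "poly q a = 0"
      using Fundamental_Theorem_Algebra.fundamental_theorem_of_algebra[of q] constant_degree[of q]
          by auto
    then obtain s where s: "a = complex_of_real s"
      using less.prems(2) by (auto elim: Reals_cases)
    from a obtain q' where q: "q = [:- a, 1:] * q'"
      by (auto simp: poly_eq_0_iff_dvd)
    \<comment> \<open>A multiple root may already lie in \<open>F\<close>; the bound there is
      recovered as a limit.\<close>
    have "eventually (\<lambda>r. r \<notin> F) (at s)"
      unfolding eventually_at_topological
      using less.prems(3) by (intro exI[of _ "- (F - {s})"] conjI open_Compl finite_imp_closed) auto
    then have "eventually (\<lambda>r. cmod (poly p (complex_of_real r))
        \<le> C * cmod (poly q (complex_of_real r))) (at s)"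
      by eventually_elim (rule less.prems(4))
    then have "cmod (poly p (complex_of_real s)) \<le> C * cmod (poly q (complex_of_real s))"
      by (rule tendsto_le[OF trivial_limit_at, rotated 2])
         (auto intro!: tendsto_intros simp: s)
    then have "poly p a = 0" using a by (simp add: s)
    then obtain p' where p: "p = [:- a, 1:] * p'"
      by (auto simp: poly_eq_0_iff_dvd)
    have "q' dvd p'"
    proof (rule less.hyps)
      show "q' \<noteq> 0" using less.prems(1) q by auto
      then show "degree q' < degree q" unfolding q by (subst degree_mult_eq) auto
      show "z \<in> \<real>" if "poly q' z = 0" for z using that less.prems(2)[of z] by (simp add: q)
      show "finite (insert s F)" using less.prems(3) by simp
      fix r assume r: "r \<notin> insert s F"
      have "cmod (complex_of_real r - a) * cmod (poly p' (complex_of_real r))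
          \<le> cmod (complex_of_real r - a) * (C * cmod (poly q' (complex_of_real r)))"
        using less.prems(4)[of r] r by (simp add: p q norm_mult[symmetric] algebra_simps)
      moreover have "cmod (complex_of_real r - a) > 0" using r s by auto
      ultimately show "cmod (poly p' (complex_of_real r)) \<le> C * cmod (poly q' (complex_of_real r))"
        by (simp only: mult_le_cancel_left_pos)
    qed
    then show ?thesis unfolding p q by (rule mult_dvd_mono[OF dvd_refl])
  qed
qed

section \<open>Extremality\<close>

text \<open>Conjugation fixes the real parameter r, so along a line through the origin the
  non-holomorphic \<open>wig_sum\<close> is a polynomial.\<close>

lemma wig_sum_ray:
  "poly (\<Sum>i\<le>N. \<Sum>j\<le>N. smult (A i j * (- 1) ^ i / (nrm j * nrm i))
      (ito j i [:0, 2 * e:] [:0, - (2 * cnj e):])) (complex_of_real r)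
   = wig_sum N A (complex_of_real r * e)"
  by (simp add: wig_sum_def poly_sum poly_ito algebra_simps)

lemma infinite_unit_circle: "infinite {z::complex. cmod z = 1}"
proof
  assume *: "finite {z::complex. cmod z = 1}"
  have "(\<lambda>t. Complex t (sqrt (1 - t\<^sup>2))) ` {0..1} \<subseteq> {z. cmod z = 1}"
    by (auto simp: cmod_def power_le_one)
  then have "finite ((\<lambda>t. Complex t (sqrt (1 - t\<^sup>2))) ` {0..1})"
    using * finite_subset by blast
  then have "finite {0..1::real}"
    by (rule finite_imageD) (auto simp: inj_on_def)
  then show False using infinite_Icc[of "0::real" 1] by simp
qed

text \<open>Injectivity of the Wigner transform, by descending induction on k = i + j: once all
  entries with larger i + j vanish, the r^k coefficient on the ray of \<open>e\<close>, times e^k,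
  is a polynomial in e^2 whose coefficients are the entries with i + j = k.\<close>

lemma wig_sum_eq_0_imp:
  assumes supp: "\<And>i j. i > N \<or> j > N \<Longrightarrow> A i j = 0"
    and zero: "\<And>e. cmod e = 1 \<Longrightarrow>
      (\<Sum>i\<le>N. \<Sum>j\<le>N. smult (A i j * (- 1) ^ i / (nrm j * nrm i))
        (ito j i [:0, 2 * e:] [:0, - (2 * cnj e):])) = 0"
  shows "A i j = 0"
proof (induction "2 * N - (i + j)" arbitrary: i j rule: less_induct)
  case (less i0 j0)
  define k where "k = i0 + j0"
  show ?case
  proof (cases "i0 \<le> N \<and> j0 \<le> N")
    case False
    then show ?thesis using supp by auto
  next
    case True
    define d where "d i j = A i j * (- 1) ^ i / (nrm j * nrm i) * (2 ^ j * (- 2) ^ i)" for i j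
    have above: "A i j = 0" if "i + j > k" for i j
    proof (cases "i \<le> N \<and> j \<le> N")
      case True
      then show ?thesis using that by (intro less.hyps) (auto simp: k_def)
    qed (use supp in auto)
    define Q where "Q = (\<Sum>i\<le>N. \<Sum>j\<le>N. if i + j = k then monom (d i j) j else 0)"
    have coeff_ray: "coeff (smult (A i j * (- 1) ^ i / (nrm j * nrm i)) (ito j i [:0, 2
        * e:] [:0, - (2 * cnj e):])) k * e ^ k
        = (if i + j = k then d i j * (e * e) ^ j else 0)" if e: "cmod e = 1" for e i j
    proof (cases "i + j" k rule: linorder_cases)
      case less
      have "coeff (ito j i [:0, 2 * e:] [:0, - (2 * cnj e):]) k = 0"
        using ito_monom_degree[of j i "2 * e" "- (2 * cnj e)"] less by (intro coeff_eq_0) auto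
      then show ?thesis using less by simp
    next
      case greater
      then show ?thesis by (simp add: above)
    next
      case equal
      have "cnj e * e = 1" using complex_norm_square[of e] e by (simp add: mult.commute)
      have "coeff (ito j i [:0, 2 * e:] [:0, - (2 * cnj e):]) k = (2 * e) ^ j * (- 2 * cnj e) ^ i"
        using ito_monom_degree[of j i "2 * e" "- (2 * cnj e)"] equal by (simp add: add.commute)
      moreover have "e ^ k = e ^ i * e ^ j"
        by (simp only: equal[symmetric] power_add)
      ultimately have "coeff (ito j i [:0, 2 * e:] [:0, - (2 * cnj e):]) k * e ^ k
          = 2 ^ j * (- 2) ^ i * (e * e) ^ j * (cnj e * e) ^ i"
        by (simp only: power_mult_distrib mult_ac)
      then show ?thesis using equal \<open>cnj e * e = 1\<close>
        by (simp only: coeff_smult d_def mult.assoc power_one mult_1_right simp_thms if_True)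
    qed
    have Q0: "poly Q (e * e) = 0" if "cmod e = 1" for e
    proof -
      have "poly Q (e * e) = (\<Sum>i\<le>N. \<Sum>j\<le>N. if i + j = k then d i j * (e * e) ^ j else 0)"
        unfolding Q_def poly_sum by (intro sum.cong) (auto simp: poly_monom)
      also have "\<dots> = coeff (\<Sum>i\<le>N. \<Sum>j\<le>N. smult (A i j * (- 1) ^ i / (nrm j * nrm i))
        (ito j i [:0, 2 * e:] [:0, - (2 * cnj e):])) k * e ^ k"
        unfolding coeff_sum sum_distrib_right by (simp only: coeff_ray[OF that])
      also have "\<dots> = 0" by (simp only: zero[OF that]) simp
      finally show ?thesis .
    qed
    have "poly Q z = 0" if "cmod z = 1" for z
    proof -
      \<comment> \<open>Squares of unit numbers exhaust the circle, so Q has infinitely many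
        roots.\<close>
      have "csqrt z * csqrt z = z" by (simp flip: power2_eq_square)
      moreover from this have "cmod (csqrt z) * cmod (csqrt z) = 1" using that
          by (simp flip: norm_mult)
      then have "cmod (csqrt z) = 1" using norm_ge_zero[of "csqrt z"]
          by (auto simp: square_eq_1_iff)
      ultimately show ?thesis using Q0[of "csqrt z"] by simp
    qed
    then have "{z. cmod z = 1} \<subseteq> {z. poly Q z = 0}" by auto
    then have "Q = 0"
      using poly_roots_finite[of Q] infinite_unit_circle finite_subset by blast
    have "coeff Q j0 = (\<Sum>i\<le>N. \<Sum>j\<le>N. if i + j = k then if j = j0 then d i j else 0 else 0)"
      unfolding Q_def coeff_sum by (intro sum.cong) auto
    also have "\<dots> = (\<Sum>j\<le>N. if i0 + j = k then if j = j0 then d i0 j else 0 else 0)"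
      by (rule sum_single) (use True in \<open>auto simp: k_def intro!: sum.neutral\<close>)
    also have "\<dots> = d i0 j0"
      by (subst sum_single[of _ j0]) (use True in \<open>auto simp: k_def\<close>)
    finally have "d i0 j0 = 0" using \<open>Q = 0\<close> by simp
    then show ?thesis by (simp add: d_def)
  qed
qed

text \<open>Without the top entry, each ray polynomial has all coefficients from index 2(m + n) on
  equal to 0, yet is divisible by a polynomial of that degree; so it vanishes.\<close>

lemma dominated_wig_sum_eq_0:
  assumes supp: "\<And>i j. i > m + n \<or> j > m + n \<Longrightarrow> A i j = 0"
    and top: "A (m + n) (m + n) = 0"
    and bound: "\<And>\<alpha>. cmod (wig_sum (m + n) A \<alpha>) \<le> C * (cmod (bs_amp m n \<alpha>))\<^sup>2"
  shows "A i j = 0"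
proof (rule wig_sum_eq_0_imp[OF supp])
  fix e :: complex assume e: "cmod e = 1"
  let ?N = "m + n"
  define P where "P = (\<Sum>i\<le>?N. \<Sum>j\<le>?N. smult (A i j * (- 1) ^ i / (nrm j * nrm i))
      (ito j i [:0, 2 * e:] [:0, - (2 * cnj e):]))"
  define s where "s = complex_of_real (sqrt 2)"
  define q where "q = ito m n [:0, s:] [:0, - s:]"
  have s0: "s \<noteq> 0" by (simp add: s_def)
  have q: "degree q \<le> ?N" "coeff q ?N = s ^ m * (- s) ^ n"
    using ito_monom_degree[of m n s "- s"] by (simp_all add: q_def)
  then have "coeff q ?N \<noteq> 0" using s0 by simp
  then have "degree q = ?N" "q \<noteq> 0" using q(1) le_degree le_antisym by (blast, auto)
  then have deg: "degree (q * q) = 2 * ?N" by (simp add: degree_mult_eq)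
  have real_roots: "z \<in> \<real>" if "poly (q * q) z = 0" for z
  proof -
    have "ito m n (s * z) (- (s * z)) = 0" using that by (simp add: q_def poly_ito mult.commute)
    then have "s * z \<in> \<real>" by (rule ito_antidiagonal_real_roots)
    then have "s * z / s \<in> \<real>" by (rule Reals_divide) (simp add: s_def)
    then show ?thesis using s0 by simp
  qed
  \<comment> \<open>Rotating the argument changes the amplitude by a phase only, so one real-rooted
    \<open>q\<close> serves all rays.\<close>
  have amp: "cmod (bs_amp m n (complex_of_real r * e)) = cmod (poly q (complex_of_real r))" for r
  proof -
    let ?x = "s * complex_of_real r"
    have ee: "e * cnj e = 1" using complex_norm_square[of e] e by simp
    have "e ^ n * ito m n (e * ?x) (- (?x * cnj e)) = e ^ m * ito m n ?x (e * (- (?x * cnj e)))"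
      by (rule ito_scale)
    also have "e * (- (?x * cnj e)) = - ?x * (e * cnj e)" by (simp add: mult_ac)
    finally have "e ^ n * ito m n (e * ?x) (- (?x * cnj e)) = e ^ m * ito m n ?x (- ?x)"
      by (simp add: ee)
    then have "cmod (e ^ n * ito m n (e * ?x) (- (?x * cnj e))) = cmod (e ^ m * ito m n ?x (- ?x))"
      by simp
    then show ?thesis
      using e by (simp add: norm_mult norm_power bs_amp_def q_def poly_ito s_def mult_ac)
  qed
  have "q * q dvd P"
  proof (rule real_rooted_dvd[where F = "{}" and C = C])
    fix r :: real
    have "poly P (complex_of_real r) = wig_sum ?N A (complex_of_real r * e)"
      unfolding P_def by (rule wig_sum_ray)
    then show "cmod (poly P (complex_of_real r)) \<le> C * cmod (poly (q * q) (complex_of_real r))"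
      using bound[of "complex_of_real r * e"] by (simp add: amp norm_mult power2_eq_square)
  qed (use \<open>q \<noteq> 0\<close> real_roots in auto)
  moreover have "coeff P k = 0" if "k \<ge> 2 * ?N" for k
    unfolding P_def coeff_sum
  proof (intro sum.neutral ballI)
    fix i j assume ij: "i \<in> {..?N}" "j \<in> {..?N}"
    show "coeff (smult (A i j * (- 1) ^ i / (nrm j * nrm i)) (ito j i [:0, 2 * e:] [:0, - (2
        * cnj e):])) k = 0"
    proof (cases "i = ?N \<and> j = ?N")
      case True
      then show ?thesis using top by simp
    next
      case False
      then have "i + j < k" using ij that by auto
      then have "coeff (ito j i [:0, 2 * e:] [:0, - (2 * cnj e):]) k = 0"
        using ito_monom_degree[of j i "2 * e" "- (2 * cnj e)"] by (intro coeff_eq_0) auto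
      then show ?thesis by simp
    qed
  qed
  ultimately have "P = 0"
    using dvd_imp_degree_le[of "q * q" P] deg leading_coeff_0_iff by metis
  then show "(\<Sum>i\<le>?N. \<Sum>j\<le>?N. smult (A i j * (- 1) ^ i / (nrm j * nrm i))
      (ito j i [:0, 2 * e:] [:0, - (2 * cnj e):])) = 0"
    by (simp only: P_def)
qed

section \<open>Positivity and the midpoint argument\<close>

lemma density_quadratic:
  assumes "density \<rho>" "finite F"
  shows "Im (\<Sum>i\<in>F. \<Sum>j\<in>F. cnj (v i) * \<rho> i j * v j) = 0"
    "Re (\<Sum>i\<in>F. \<Sum>j\<in>F. cnj (v i) * \<rho> i j * v j) \<ge> 0"
  using assms unfolding density_def Let_def by blast+

lemma density_diag:
  assumes "density \<rho>"
  shows "Im (\<rho> i i) = 0" "Re (\<rho> i i) \<ge> 0"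
  using density_quadratic[OF assms, of "{i}" "\<lambda>_. 1"] by auto

text \<open>With a zero diagonal entry, the form on t e_i + e_j is real-affine in t; being bounded
  below, it has no linear part.\<close>

lemma density_zero_diag:
  assumes "density \<rho>" "\<rho> i i = 0"
  shows "\<rho> i j = 0 \<and> \<rho> j i = 0"
proof (cases "i = j")
  case False
  have q: "Im (cnj t * \<rho> i j + t * \<rho> j i + \<rho> j j)
      = 0 \<and> Re (cnj t * \<rho> i j + t * \<rho> j i + \<rho> j j) \<ge> 0" for t
    using density_quadratic[OF assms(1), of "{i, j}" "\<lambda>k. if k = i then t else 1"] False assms(2)
    by (simp add: algebra_simps)
  define x where "x = Re (\<rho> i j)"
  define y where "y = Im (\<rho> i j)"
  \<comment> \<open>The test values t = 1 and t = \<i> recover hermiticity from the real-valuedness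
    of the form.\<close>
  have "Im (\<rho> j i) = - y" using q[of 1] density_diag(1)[OF assms(1), of j] by (simp add: y_def)
  moreover have "Re (\<rho> j i) = x" using q[of \<i>] density_diag(1)[OF assms(1), of j]
      by (simp add: x_def)
  ultimately have *: "2 * (Re t * x + Im t * y) + Re (\<rho> j j) \<ge> 0" for t
    using q[of t] by (simp add: x_def y_def algebra_simps)
  \<comment> \<open>Chosen so that 2 c + Re (\<rho> j j) < 0; the vector (x, y) rescaled by c / (x^2
    + y^2) attains this value.\<close>
  define c where "c = - (Re (\<rho> j j) + 1)"
  have "x = 0 \<and> y = 0"
  proof (rule ccontr)
    assume "\<not> ?thesis"
    then have p: "x * x + y * y > 0" by (auto simp: sum_squares_gt_zero_iff)
    have "Re (Complex (c * x / (x * x + y * y)) (c * y / (x * x + y * y))) * x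
       + Im (Complex (c * x / (x * x + y * y)) (c * y / (x * x + y * y))) * y
       = c * (x * x + y * y) / (x * x + y * y)"
      by (simp add: algebra_simps add_divide_distrib)
    also have "\<dots> = c" using p by (intro nonzero_mult_div_cancel_right) linarith
    finally have "2 * c + Re (\<rho> j j) \<ge> 0" using * by metis
    then show False using density_diag(2)[OF assms(1), of j] by (simp add: c_def)
  qed
  then show ?thesis using \<open>Im (\<rho> j i) = - y\<close> \<open>Re (\<rho> j i) = x\<close>
    by (auto simp: complex_eq_iff x_def y_def)
qed (use assms in auto)

lemma Dplus_wig_sum:
  assumes "A \<in> Dplus" "\<And>i j. i > N \<or> j > N \<Longrightarrow> A i j = 0"
  shows "Im (wig_sum N A \<alpha>) = 0" "Re (wig_sum N A \<alpha>) \<ge> 0"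
proof -
  define c where "c = 2 / pi * exp (- (2 * (cmod \<alpha>)\<^sup>2))"
  have "c > 0" by (simp add: c_def)
  moreover have "wigner A \<alpha> = complex_of_real c * wig_sum N A \<alpha>"
    unfolding c_def by (rule wigner_eq) (rule assms(2))
  moreover have "Im (wigner A \<alpha>) = 0" "Re (wigner A \<alpha>) \<ge> 0"
    using assms(1) unfolding Dplus_def by auto
  ultimately show "Im (wig_sum N A \<alpha>) = 0" "Re (wig_sum N A \<alpha>) \<ge> 0"
    by (auto simp: zero_le_mult_iff)
qed

lemma bs_state_Dplus: "bs_state m n \<in> Dplus"
proof -
  let ?N = "m + n"
  have supp: "bs_state m n i j = 0" if "i > ?N \<or> j > ?N" for i j
    using that by (auto simp: bs_state_eq)
  have "density (bs_state m n)"
    unfolding density_def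
  proof (intro conjI allI impI)
    fix F :: "nat set" and v :: "nat \<Rightarrow> complex" assume F: "finite F"
    define w where "w i = (if i \<le> ?N then bs_weight m n i else 0)" for i
    have "(\<Sum>i\<in>F. \<Sum>j\<in>F. cnj (v i) * bs_state m n i j * v j)
        = (\<Sum>i\<in>F. complex_of_real (w i * (cmod (v i))\<^sup>2))"
    proof (rule sum.cong[OF refl])
      fix i assume i: "i \<in> F"
      have "(\<Sum>j\<in>F. cnj (v i) * bs_state m n i j * v j) = cnj (v i) * bs_state m n i i * v i"
        by (rule sum_single) (use F i in \<open>auto simp: bs_state_eq\<close>)
      also have "\<dots> = complex_of_real (w i * (cmod (v i))\<^sup>2)"
        unfolding of_real_mult complex_norm_square by (simp add: bs_state_eq w_def)
      finally show "(\<Sum>j\<in>F. cnj (v i) * bs_state m n i j * v j)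
          = complex_of_real (w i * (cmod (v i))\<^sup>2)" .
    qed
    also have "\<dots> = complex_of_real (\<Sum>i\<in>F. w i * (cmod (v i))\<^sup>2)" by simp
    finally have "(\<Sum>i\<in>F. \<Sum>j\<in>F. cnj (v i) * bs_state m n i j * v j)
        = complex_of_real (\<Sum>i\<in>F. w i * (cmod (v i))\<^sup>2)" .
    moreover have "(\<Sum>i\<in>F. w i * (cmod (v i))\<^sup>2) \<ge> 0"
      by (intro sum_nonneg) (simp add: w_def bs_weight_nonneg)
    ultimately show "let q = (\<Sum>i\<in>F. \<Sum>j\<in>F. cnj (v i) * bs_state m n i j * v j) in Im q = 0 \<and> 0
        \<le> Re q"
      by (simp only: Let_def Im_complex_of_real Re_complex_of_real)
  next
    have "(\<Sum>i\<le>?N. bs_state m n i i) = complex_of_real (\<Sum>i\<le>?N. bs_weight m n i)"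
      by (simp add: bs_state_eq)
    then have "((\<lambda>i. bs_state m n i i) has_sum 1) {..?N}"
      using sum_bs_weight[of m n] by (intro has_sum_finiteI) auto
    then show "((\<lambda>i. bs_state m n i i) has_sum 1) UNIV"
      by (rule has_sum_cong_neutral[THEN iffD1, rotated -1]) (auto simp: supp)
  qed
  moreover have "Im (wigner (bs_state m n) \<alpha>) = 0 \<and> Re (wigner (bs_state m n) \<alpha>) \<ge> 0" for \<alpha>
  proof -
    have "wigner (bs_state m n) \<alpha> = complex_of_real (2 / pi * exp (- (2 * (cmod \<alpha>)\<^sup>2)))
        * wig_sum ?N (bs_state m n) \<alpha>"
      by (rule wigner_eq) (rule supp)
    also have "\<dots> = complex_of_real (2 / pi * exp (- (2 * (cmod \<alpha>)\<^sup>2))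
        * ((cmod (bs_amp m n \<alpha>))\<^sup>2 / (fact m * fact n)))"
      by (simp only: wig_sum_bs_state of_real_mult)
    finally show ?thesis
      by (simp only: Im_complex_of_real Re_complex_of_real) simp
  qed
  ultimately show ?thesis by (simp add: Dplus_def)
qed

lemma bs_state_midpoint:
  assumes a: "a \<in> Dplus" and b: "b \<in> Dplus"
    and mid: "bs_state m n = (\<lambda>i j. (a i j + b i j) / 2)"
  shows "a = bs_state m n"
proof -
  let ?N = "m + n"
  let ?\<sigma> = "bs_state m n"
  have da: "density a" and db: "density b" using a b by (auto simp: Dplus_def)
  have sum: "a i j + b i j = 2 * ?\<sigma> i j" for i j
    using fun_cong[OF fun_cong[OF mid, of i], of j] by (simp add: mult.commute)
  \<comment> \<open>Non-negative diagonals with sum zero vanish; \<open>density_zero_diag\<close>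
    then clears whole rows and columns.\<close>
  have diag: "a i i = 0 \<and> b i i = 0" if "i > ?N" for i
    using sum[of i i] that density_diag[OF da, of i] density_diag[OF db, of i]
    by (auto simp: bs_state_eq complex_eq_iff)
  have supp_a: "a i j = 0" and supp_b: "b i j = 0" if "i > ?N \<or> j > ?N" for i j
    using that density_zero_diag[OF da, of i j] density_zero_diag[OF da, of j i]
      density_zero_diag[OF db, of i j] density_zero_diag[OF db, of j i] diag by auto
  have supp: "?\<sigma> i j = 0" if "i > ?N \<or> j > ?N" for i j
    using that by (auto simp: bs_state_eq)
  have wig_lin: "wig_sum ?N (\<lambda>i j. x * A i j + y * B i j) \<alpha>
      = x * wig_sum ?N A \<alpha> + y * wig_sum ?N B \<alpha>"
    for x y A B \<alpha>
    by (simp add: wig_sum_def algebra_simps sum.distrib sum_distrib_left add_divide_distrib)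
  define s where "s = ?\<sigma> ?N ?N"
  define t where "t = a ?N ?N"
  \<comment> \<open>The combination whose top entry cancels; its vanishing makes \<open>a\<close>
    proportional to the state.\<close>
  define B where "B = (\<lambda>i j. s * a i j + (- t) * ?\<sigma> i j)"
  have s0: "s \<noteq> 0" using bs_weight_top[of m n] by (simp add: s_def bs_state_eq)
  have dom: "cmod (wig_sum ?N a \<alpha>) \<le> 2 * cmod (wig_sum ?N ?\<sigma> \<alpha>)" for \<alpha>
  proof -
    have "wig_sum ?N a \<alpha> + wig_sum ?N b \<alpha> = 2 * wig_sum ?N ?\<sigma> \<alpha>"
      using wig_lin[of 1 a 1 b \<alpha>] wig_lin[of 2 ?\<sigma> 0 ?\<sigma> \<alpha>] by (simp add: sum)
    moreover have "Im (wig_sum ?N a \<alpha>) = 0" "Re (wig_sum ?N a \<alpha>) \<ge> 0" "Re (wig_sum ?N b \<alpha>) \<ge> 0"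
      using Dplus_wig_sum[where N = ?N and \<alpha> = \<alpha>, OF a supp_a] Dplus_wig_sum[where N = ?N and \<alpha>
          = \<alpha>, OF b supp_b] by auto
    ultimately have "cmod (wig_sum ?N a \<alpha>) \<le> Re (2 * wig_sum ?N ?\<sigma> \<alpha>)"
      by (auto simp: cmod_eq_Re complex_eq_iff)
    also have "\<dots> \<le> 2 * cmod (wig_sum ?N ?\<sigma> \<alpha>)" using complex_Re_le_cmod[of "wig_sum ?N ?\<sigma> \<alpha>"]
        by simp
    finally show ?thesis .
  qed
  have B0: "B i j = 0" for i j
  proof (rule dominated_wig_sum_eq_0[of m n B])
    show "B i j = 0" if "i > ?N \<or> j > ?N" for i j using that by (simp add: B_def supp_a supp)
    show "B ?N ?N = 0" by (simp add: B_def s_def t_def)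
    fix \<alpha>
    have "cmod (wig_sum ?N B \<alpha>) \<le> cmod s * cmod (wig_sum ?N a \<alpha>) + cmod t * cmod (wig_sum ?N ?\<sigma> \<alpha>)"
      unfolding B_def wig_lin using norm_triangle_ineq[of "s * wig_sum ?N a \<alpha>" "(- t)
          * wig_sum ?N ?\<sigma> \<alpha>"]
      by (simp add: norm_mult)
    also have "\<dots> \<le> (2 * cmod s + cmod t) * cmod (wig_sum ?N ?\<sigma> \<alpha>)"
      using mult_left_mono[OF dom[of \<alpha>], of "cmod s"] by (simp add: algebra_simps)
    also have "\<dots> = (2 * cmod s + cmod t) / (fact m * fact n) * (cmod (bs_amp m n \<alpha>))\<^sup>2"
      by (simp add: wig_sum_bs_state norm_divide norm_mult norm_power)
    finally show "cmod (wig_sum ?N B \<alpha>) \<le> (2 * cmod s + cmod t) / (fact m * fact n)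
        * (cmod (bs_amp m n \<alpha>))\<^sup>2" .
  qed
  have proportional: "s * a i j = t * ?\<sigma> i j" for i j
    using B0[of i j] by (simp add: B_def)
  have trace: "(\<Sum>i\<le>?N. A i i) = 1" if "density A" "\<And>i. i > ?N \<Longrightarrow> A i i = 0" for A
  proof -
    have "((\<lambda>i. A i i) has_sum 1) UNIV" using that by (simp add: density_def)
    then have "((\<lambda>i. A i i) has_sum 1) {..?N}"
      by (rule has_sum_cong_neutral[THEN iffD1, rotated -1]) (auto simp: that)
    then show ?thesis using has_sum_finite[of "{..?N}" "\<lambda>i. A i i"] has_sum_unique by blast
  qed
  have "s * (\<Sum>i\<le>?N. a i i) = t * (\<Sum>i\<le>?N. ?\<sigma> i i)"
    by (simp add: sum_distrib_left proportional)
  moreover have "(\<Sum>i\<le>?N. a i i) = 1" using da supp_a by (intro trace) auto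
  moreover have "(\<Sum>i\<le>?N. ?\<sigma> i i) = 1"
    using bs_state_Dplus[of m n] supp by (intro trace) (auto simp: Dplus_def)
  ultimately have "s = t" by simp
  then show ?thesis using proportional s0 by (auto simp: fun_eq_iff)
qed

theorem theorem4:
  fixes m n :: nat
  shows "extreme_in (bs_state m n) Dplus"
proof -
  have "a = b" if "a \<in> Dplus" "b \<in> Dplus" "bs_state m n = (\<lambda>i j. (a i j + b i j) / 2)" for a b
  proof -
    have "(\<lambda>i j. (a i j + b i j) / 2) = (\<lambda>i j. (b i j + a i j) / 2)"
      by (simp only: add.commute)
    with that(3) have "bs_state m n = (\<lambda>i j. (b i j + a i j) / 2)" by (rule trans)
    then show ?thesis
      using bs_state_midpoint[OF that] bs_state_midpoint[OF that(2,1)] by metis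
  qed
  then show ?thesis
    unfolding extreme_in_def using bs_state_Dplus by blast
qed

end
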